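(* Let $G$ be a finite group and let $\mathcal C = \mathcal C(\mathcal B(G), \mathcal F(G))$ be the class semigroup of $\mathcal B(G)$ in $\mathcal F(G)$. Then the following statements are equivalent: (a) $\mathcal C$ is a Clifford semigroup. (b) $\mathcal B(G)$ is a seminormal monoid. Suppose that $\mathcal C$ is a Clifford semigroup. Let $S_1,\ldots,S_n \in \mathcal F(G)$ be such that $\mathsf E(\mathcal C) = \{[S_1],\ldots,[S_n]\}$, and let $\mathcal C_i = [S_i]+\mathcal C$ for all $i\in[1,n]$. Then the map $$\varphi\colon \mathcal C \to \mathcal C^{*} = \big\{ ([T\cdot S_1],\ldots,[T\cdot S_n]) \mid T\in\mathcal F(G)\big\} \subset \prod_{i=1}^n \mathcal C_i,$$ defined by $\varphi([T]) = ([T\cdot S_1],\ldots,[T\cdot S_n])$ for all $T\in\mathcal F(G)$, is an isomorphism with the following properties: 1. If $i,j\in[1,n]$ and $T\in\mathcal F(G)$ is a sequence with $[T]\in\mathcal H([S_i])$, then $[S_j]\le[S_i]$ if and only if $[T\cdot S_j]\in\mathcal H([S_j])$. In particular, $\mathcal C^{*}$ has no zero element. 2. For every $i\in[1,n]$, $\mathcal C_i = \bigcup \mathcal H([S_j])$, where the union is taken over those $j\in[1,n]$ with $[S_j]\le[S_i]$. 3. For every $i\in[1,n]$, the restriction of the projection $p_i|_{\mathcal C^{*}}\colon \mathcal C^{*}\to \mathcal C_i/(\mathcal C_i\setminus\mathcal C_i^{\times})$ is surjective. 4. $\mathcal B(G) = \bigcup_{i=1}^n \{T\in\mathcal F(G)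 \mid [T]\in\ker(\varphi_{[S_i]})\}$.
   Context: Let $G$ be a finite group with identity $1_G$. $\mathcal F(G)$ is the free abelian monoid with basis $G$, its operation written $\cdot$ ; its elements are called sequences over $G$ (finite, unordered, repetition allowed), its identity is the empty sequence $1_{\mathcal F(G)}$, and $\mathrm{supp}(S)\subset G$ is the set of elements occurring in $S$. For $S=g_1\cdot\ldots\cdot g_\ell$, $\pi(S)=\{g_{\tau(1)}\cdots g_{\tau(\ell)}\in G \mid \tau \text{ a permutation of } [1,\ell]\}$, with $\pi(1_{\mathcal F(G)})=\{1_G\}$. The monoid of product-one sequences is $\mathcal B(G)=\{S\in\mathcal F(G)\mid 1_G\in\pi(S)\}$, a submonoid of $\mathcal F(G)$. For $S,S'\in\mathcal F(G)$ write $S\sim S'$ if for all $T\in\mathcal F(G)$: $S\cdot T\in\mathcal B(G)\Leftrightarrow S'\cdot T\in\mathcal B(G)$. This is a congruence; $[S]$ is the class of $S$, and $\mathcal C(\mathcal B(G),\mathcal F(G))=\{[S]\mid S\in\mathcal F(G)\}$, written additively with $[S]+[S']=[S\cdot S']$, is the class semigroup. It is a finite commutative semigroup with identity $[1_{\mathcal F(G)}]$. If $S\sim S'$ then $\pi(S)=\pi(S')$. For a commutative semigroup $\mathcal C$ with identity (additive): $\mathsf E(\mathcal C)$ is the set of idempotents, ordered by the Rees order $e\le f$ iff $e+f=e$. Green's relation is $a\,\mathcal H\,b$ iff $a+\mathcal C=b+\mathcal C$, and $\mathcal H(a)$ is the $\mathcal H$-class of $a$; for $e\in\mathsf E(\mathcal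 C)$, $\mathcal H(e)$ is a group with identity $e$. $\mathcal C$ is a Clifford semigroup if every element lies in a subgroup of $\mathcal C$. If $e$ is idempotent, $e+\mathcal C$ is a subsemigroup with identity element $e$; $\mathcal C_i^\times$ denotes the group of invertible elements of $\mathcal C_i$ (with respect to the identity $[S_i]$). For an ideal $I$ of a commutative semigroup $A$ the Rees quotient is the semigroup $A/I=(A\setminus I)\cup\{0\}$, where $0$ is a zero element and a product is as in $A$ if both factors and their product lie in $A\setminus I$ and is $0$ otherwise. In item 3, $p_i$ is the projection onto the $i$-th coordinate, followed by the canonical map $\mathcal C_i\to\mathcal C_i/(\mathcal C_i\setminus\mathcal C_i^\times)$, which is the identity on $\mathcal C_i^\times$ and sends $\mathcal C_i\setminus\mathcal C_i^\times$ to $0$. A (commutative, cancellative) monoid $H$ with quotient group $\mathsf q(H)$ is seminormal if $x\in\mathsf q(H)$ and $x^2,x^3\in H$ imply $x\in H$. The homomorphisms $\varphi_{[S]}$: for an idempotent class $[S]$, let $G_0\subset G$ be the subgroup generated by all $\mathrm{supp}(S')$, where $S'$ ranges over the sequences $S'\in\mathcal B(G)$ with $[S']=[S]$. Then for every $T\in\mathcal F(G)$ with $[T]\in\mathcal H([S])$, $\pi(T)$ is a coset of $G_0'$ contained in $G_0$, and $\varphi_{[S]}\colon\mathcal H([S])\to G_0/G_0'$, $[T]\mapsto\pi(T)$, is a group homomorphism. Here $G_0'$ is the commutator subgroup of $G_0$.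
   Formalization: In item 3 no zero is adjoined to the Rees quotient when C_i∖C_i^× is empty (otherwise surjectivity fails, e.g. for abelian G), and "no zero element" excludes a one-element C* (trivial G), whose only element is a zero. *)

theory Defs
  imports "HOL-Algebra.Algebra" "HOL-Library.Multiset"
begin

text \<open>All semigroups are \<open>monoid\<close> records of HOL-Algebra, written multiplicatively, also where
  the additive notation is customary (class semigroups).\<close>

section \<open>Sequences over a group\<close>

definition sequences :: "('a, 'b) monoid_scheme \<Rightarrow> 'a multiset monoid" where
  "sequences G = \<lparr>carrier = {S. set_mset S \<subseteq> carrier G}, monoid.mult = (+), one = {#}\<rparr>"

definition products :: "('a, 'b) monoid_scheme \<Rightarrow> 'a multiset \<Rightarrow> 'a set" where
  "products G S = {foldr (\<otimes>\<^bsub>G\<^esub>) xs \<one>\<^bsub>G\<^esub> | xs. mset xs = S}"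

definition product_one :: "('a, 'b) monoid_scheme \<Rightarrow> 'a multiset monoid" where
  "product_one G =
     (sequences G)\<lparr>carrier := {S \<in> carrier (sequences G). \<one>\<^bsub>G\<^esub> \<in> products G S}\<rparr>"


section \<open>The class semigroup of a submonoid \<open>H\<close> of \<open>F\<close>\<close>

definition class_congruence :: "('s, 'h) monoid_scheme \<Rightarrow> ('s, 'f) monoid_scheme \<Rightarrow> ('s \<times> 's) set" where
  "class_congruence H F = {(S, S'). S \<in> carrier F \<and> S' \<in> carrier F \<and>
     (\<forall>T \<in> carrier F. S \<otimes>\<^bsub>F\<^esub> T \<in> carrier H \<longleftrightarrow> S' \<otimes>\<^bsub>F\<^esub> T \<in> carrier H)}"

definition congruence_class :: "('s, 'h) monoid_scheme \<Rightarrow> ('s, 'f) monoid_scheme \<Rightarrow> 's \<Rightarrow> 's set" where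
  "congruence_class H F S = class_congruence H F `` {S}"

definition class_semigroup ::
    "('s, 'h) monoid_scheme \<Rightarrow> ('s, 'f) monoid_scheme \<Rightarrow> 's set monoid" where
  "class_semigroup H F =
     \<lparr>carrier = congruence_class H F ` carrier F,
      monoid.mult = (\<lambda>A B. \<Union>S\<in>A. \<Union>T\<in>B. congruence_class H F (S \<otimes>\<^bsub>F\<^esub> T)),
      one = congruence_class H F \<one>\<^bsub>F\<^esub>\<rparr>"

abbreviation seq_class :: "('a, 'b) monoid_scheme \<Rightarrow> 'a multiset \<Rightarrow> 'a multiset set" where
  "seq_class G \<equiv> congruence_class (product_one G) (sequences G)"

abbreviation seq_class_semigroup :: "('a, 'b) monoid_scheme \<Rightarrow> 'a multiset set monoid" where
  "seq_class_semigroup G \<equiv> class_semigroup (product_one G) (sequences G)"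


section \<open>Commutative semigroups with identity\<close>

definition idempotents :: "('c, 'd) monoid_scheme \<Rightarrow> 'c set" where
  "idempotents C = {e \<in> carrier C. e \<otimes>\<^bsub>C\<^esub> e = e}"

definition rees_le :: "('c, 'd) monoid_scheme \<Rightarrow> 'c \<Rightarrow> 'c \<Rightarrow> bool" where
  "rees_le C e f \<longleftrightarrow> e \<otimes>\<^bsub>C\<^esub> f = e"

definition translate :: "('c, 'd) monoid_scheme \<Rightarrow> 'c \<Rightarrow> 'c set" where
  "translate C a = {a \<otimes>\<^bsub>C\<^esub> c | c. c \<in> carrier C}"

definition green_H :: "('c, 'd) monoid_scheme \<Rightarrow> 'c \<Rightarrow> 'c set" where
  "green_H C a = {b \<in> carrier C. translate C a = translate C b}"

definition H_group :: "('c, 'd) monoid_scheme \<Rightarrow> 'c \<Rightarrow> ('c, 'd) monoid_scheme" where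
  "H_group C e = C\<lparr>carrier := green_H C e, one := e\<rparr>"

definition clifford :: "('c, 'd) monoid_scheme \<Rightarrow> bool" where
  "clifford C \<longleftrightarrow>
     (\<forall>a \<in> carrier C. \<exists>K e. a \<in> K \<and> K \<subseteq> carrier C \<and> group (C\<lparr>carrier := K, one := e\<rparr>))"

definition local_monoid :: "('c, 'd) monoid_scheme \<Rightarrow> 'c \<Rightarrow> ('c, 'd) monoid_scheme" where
  "local_monoid C e = C\<lparr>carrier := translate C e, one := e\<rparr>"

text \<open>As usual, a one-element semigroup is not regarded as a semigroup with zero: a zero
  element presupposes a second element.\<close>

definition has_zero :: "('c, 'd) monoid_scheme \<Rightarrow> bool" where
  "has_zero A \<longleftrightarrow> (\<exists>z \<in> carrier A. carrier A \<noteq> {z} \<and>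
     (\<forall>a \<in> carrier A. z \<otimes>\<^bsub>A\<^esub> a = z \<and> a \<otimes>\<^bsub>A\<^esub> z = z))"

text \<open>Rees quotients: \<open>None\<close> is the zero element.  By the usual convention \<open>A / {} = A\<close>, that is,
  no zero is adjoined when the ideal is empty.\<close>

definition rees_map :: "'c set \<Rightarrow> 'c \<Rightarrow> 'c option" where
  "rees_map I a = (if a \<in> I then None else Some a)"

definition rees_quotient :: "('c, 'd) monoid_scheme \<Rightarrow> 'c set \<Rightarrow> 'c option monoid" where
  "rees_quotient A I =
     \<lparr>carrier = Some ` (carrier A - I) \<union> (if I = {} then {} else {None}),
      monoid.mult = (\<lambda>x y. case (x, y) of
                (Some a, Some b) \<Rightarrow> rees_map I (a \<otimes>\<^bsub>A\<^esub> b)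
              | _ \<Rightarrow> None),
      one = rees_map I \<one>\<^bsub>A\<^esub>\<rparr>"


section \<open>Quotient groups of cancellative monoids and seminormality\<close>

definition fraction_rel :: "('h, 'b) monoid_scheme \<Rightarrow> (('h \<times> 'h) \<times> ('h \<times> 'h)) set" where
  "fraction_rel H = {((a, b), (c, d)). a \<in> carrier H \<and> b \<in> carrier H \<and> c \<in> carrier H \<and>
     d \<in> carrier H \<and> a \<otimes>\<^bsub>H\<^esub> d = c \<otimes>\<^bsub>H\<^esub> b}"

definition fraction :: "('h, 'b) monoid_scheme \<Rightarrow> 'h \<Rightarrow> 'h \<Rightarrow> ('h \<times> 'h) set" where
  "fraction H a b = fraction_rel H `` {(a, b)}"

definition quotient_group :: "('h, 'b) monoid_scheme \<Rightarrow> ('h \<times> 'h) set monoid" where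
  "quotient_group H =
     \<lparr>carrier = {fraction H a b | a b. a \<in> carrier H \<and> b \<in> carrier H},
      monoid.mult = (\<lambda>x y. \<Union>(a, b)\<in>x. \<Union>(c, d)\<in>y. fraction H (a \<otimes>\<^bsub>H\<^esub> c) (b \<otimes>\<^bsub>H\<^esub> d)),
      one = fraction H \<one>\<^bsub>H\<^esub> \<one>\<^bsub>H\<^esub>\<rparr>"

definition quotient_embed :: "('h, 'b) monoid_scheme \<Rightarrow> 'h \<Rightarrow> ('h \<times> 'h) set" where
  "quotient_embed H a = fraction H a \<one>\<^bsub>H\<^esub>"

definition seminormal :: "('h, 'b) monoid_scheme \<Rightarrow> bool" where
  "seminormal H \<longleftrightarrow> comm_monoid_cancel H \<and>
     (\<forall>x \<in> carrier (quotient_group H).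
        x [^]\<^bsub>quotient_group H\<^esub> (2::nat) \<in> quotient_embed H ` carrier H \<and>
        x [^]\<^bsub>quotient_group H\<^esub> (3::nat) \<in> quotient_embed H ` carrier H
        \<longrightarrow> x \<in> quotient_embed H ` carrier H)"


section \<open>The homomorphism attached to an idempotent class\<close>

text \<open>\<open>support_group G A\<close> is \<open>G\<^sub>0\<close> for the idempotent class \<open>A\<close>.  Equivalent sequences have the same
  set of products, so \<open>class_products G A\<close> is that common set, and \<open>class_products G\<close>, restricted
  to the maximal subgroup at \<open>A\<close>, is the homomorphism into \<open>G\<^sub>0 / G\<^sub>0'\<close>.\<close>

definition support_group :: "('a, 'b) monoid_scheme \<Rightarrow> 'a multiset set \<Rightarrow> ('a, 'b) monoid_scheme" where
  "support_group G A =
     G\<lparr>carrier := generate G (\<Union>S \<in> A \<inter> carrier (product_one G). set_mset S)\<rparr>"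

definition class_products :: "('a, 'b) monoid_scheme \<Rightarrow> 'a multiset set \<Rightarrow> 'a set" where
  "class_products G A = the_elem (products G ` A)"

definition abelianization :: "('a, 'b) monoid_scheme \<Rightarrow> 'a set monoid" where
  "abelianization G = G Mod derived G (carrier G)"

definition phi_kernel :: "('a, 'b) monoid_scheme \<Rightarrow> 'a multiset set \<Rightarrow> 'a multiset set set" where
  "phi_kernel G A = kernel (H_group (seq_class_semigroup G) A)
     (abelianization (support_group G A)) (class_products G)"


section \<open>The subdirect product \<open>C\<^sup>*\<close>\<close>

definition comp_monoid ::
    "('a, 'b) monoid_scheme \<Rightarrow> (nat \<Rightarrow> 'a multiset) \<Rightarrow> nat \<Rightarrow> 'a multiset set monoid" where
  "comp_monoid G S i = local_monoid (seq_class_semigroup G) (seq_class G (S i))"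

definition star_tuple :: "('a, 'b) monoid_scheme \<Rightarrow> nat \<Rightarrow> (nat \<Rightarrow> 'a multiset) \<Rightarrow>
    'a multiset \<Rightarrow> (nat \<Rightarrow> 'a multiset set)" where
  "star_tuple G n S T = (\<lambda>i\<in>{1..n}. seq_class G (T \<otimes>\<^bsub>sequences G\<^esub> S i))"

definition star :: "('a, 'b) monoid_scheme \<Rightarrow> nat \<Rightarrow> (nat \<Rightarrow> 'a multiset) \<Rightarrow>
    (nat \<Rightarrow> 'a multiset set) monoid" where
  "star G n S = (product_group {1..n} (comp_monoid G S))
     \<lparr>carrier := {star_tuple G n S T | T. T \<in> carrier (sequences G)}\<rparr>"

definition non_units :: "('c, 'd) monoid_scheme \<Rightarrow> 'c set" where
  "non_units A = carrier A - Units A"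

definition star_proj :: "('a, 'b) monoid_scheme \<Rightarrow> (nat \<Rightarrow> 'a multiset) \<Rightarrow> nat \<Rightarrow>
    (nat \<Rightarrow> 'a multiset set) \<Rightarrow> 'a multiset set option" where
  "star_proj G S i x = rees_map (non_units (comp_monoid G S i)) (x i)"

end

theory Submission
  imports Defs
begin

text \<open>Seminormality of \<open>\<B>(G)\<close> says that a sequence is product-one as soon as all its large powers
  are.  By Dickson's lemma every sequence \<open>T\<close> has a power whose class is idempotent, and the Clifford
  property says that \<open>[T\<^sup>k\<^sup>+\<^sup>1] = [T]\<close> for such a power \<open>T\<^sup>k\<close>; comparing high powers of \<open>T \<cdot> W\<close> for
  all \<open>W\<close> shows that the two conditions agree.  A product-one sequence in \<open>\<H>(e)\<close> already has class
  \<open>e\<close>, and its products form exactly the derived subgroup of the group generated by all product-one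
  sequences in \<open>e\<close>.  A zero class would force \<open>G\<close> to be perfect, whereas the Clifford property
  applied to \<open>g \<cdot> h\<close>, which has at most two products, makes all squares and hence all commutators
  central.\<close>

section \<open>Dickson's lemma\<close>

text \<open>Dickson's lemma stands in for the finiteness of the class semigroup: all that is
  required is that every \<open>T\<close> has a power with idempotent class. The exponents are kept
  divisible by \<open>order G\<close> because such a power is itself product-one. Adding it never
  destroys product-one membership, which gives both the monotonicity behind the stabilisation
  argument and the easy half of [T] = [T^(k+1)]. The link from classes to product sets is the test
  with the single term \<open>inv g\<close>. The last steps against a zero are these. Once squares
  are central, the commutator of a and b is the product of the squares of a b, \<open>inv a\<close>
  and \<open>inv b\<close>. So all commutators are central, and a perfect G is abelian, hence
  trivial. For the trivial group the class semigroup has one element, which is why the convention on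
  zeros asks for a second element. Injectivity of the map into the product has a simple source: the
  class of the empty sequence is idempotent, so it is one of the [S_i], and that coordinate of the
  tuple of T is [T] itself.\<close>

lemma ascending_subsequence:
  fixes g :: "nat \<Rightarrow> nat"
  shows "\<exists>s :: nat \<Rightarrow> nat. strict_mono s \<and> (\<forall>i j. i \<le> j \<longrightarrow> g (s i) \<le> g (s j))"
proof -
  \<comment> \<open>Past every \<open>x\<close> the function attains a minimum; at its position
    \<open>y\<close> the value is below all later ones too. Jumping from one such position to the
    next yields the subsequence.\<close>
  have least: "\<exists>y>x. \<forall>j\<ge>y. g y \<le> g j" for x
  proof -
    obtain y where "y > x" "\<forall>j. j > x \<longrightarrow> g y \<le> g j"
      using ex_has_least_nat[of "\<lambda>y. y > x" "Suc x" g] by auto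
    then have "\<forall>j\<ge>y. g y \<le> g j" by auto
    with \<open>y > x\<close> show ?thesis by blast
  qed
  have "\<exists>s. \<forall>n. (\<forall>j\<ge>s n. g (s n) \<le> g j) \<and> s n < s (Suc n)"
    by (rule dependent_nat_choice) (use least in blast)+
  then obtain s where s: "\<And>n j. j \<ge> s n \<Longrightarrow> g (s n) \<le> g j" and "\<And>n. s n < s (Suc n)" by blast
  then have "strict_mono s" by (simp add: strict_mono_Suc_iff)
  moreover from this have "g (s i) \<le> g (s j)" if "i \<le> j" for i j
    using s[of i "s j"] that by (simp add: strict_mono_less_eq)
  ultimately show ?thesis by blast
qed

text \<open>Coordinates are treated one at a time: monotonicity in the coordinates already handled
  survives passing to a further subsequence, so the selections can be composed.\<close>

lemma dickson_subsequence:
  fixes f :: "nat \<Rightarrow> 'a \<Rightarrow> nat"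
  assumes "finite A"
  shows "\<exists>r :: nat \<Rightarrow> nat. strict_mono r \<and> (\<forall>a\<in>A. \<forall>i j. i \<le> j \<longrightarrow> f (r i) a \<le> f (r j) a)"
  using assms
proof (induction A rule: finite_induct)
  case empty
  show ?case by (intro exI[of _ id]) (simp add: strict_mono_def)
next
  case (insert x A)
  from insert.IH obtain r :: "nat \<Rightarrow> nat" where r: "strict_mono r"
    "\<forall>a\<in>A. \<forall>i j. i \<le> j \<longrightarrow> f (r i) a \<le> f (r j) a" by blast
  obtain s :: "nat \<Rightarrow> nat" where s: "strict_mono s" "\<And>i j. i \<le> j \<Longrightarrow> f (r (s i)) x \<le> f (r (s j)) x"
    using ascending_subsequence[of "\<lambda>i. f (r i) x"] by metis
  have "strict_mono (r \<circ> s)" using r(1) s(1) by (rule strict_mono_o)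
  moreover have "f ((r \<circ> s) i) a \<le> f ((r \<circ> s) j) a" if "a \<in> insert x A" "i \<le> j" for a i j
  proof (cases "a = x")
    case True
    then show ?thesis using s(2) that by simp
  next
    case False
    moreover have "s i \<le> s j" using s(1) that by (simp add: strict_mono_less_eq)
    ultimately show ?thesis using r(2) that by simp
  qed
  ultimately show ?case by blast
qed

lemma repeat_mset_of_dvd_count:
  assumes "\<And>x. m dvd count V x" and "m > 0"
  shows "\<exists>U. V = repeat_mset m U"
proof -
  have "finite {x. 0 < count V x div m}"
    by (rule finite_subset[of _ "set_mset V"]) (auto simp: div_greater_zero_iff intro: count_inI)
  then have "count (Abs_multiset (\<lambda>x. count V x div m)) = (\<lambda>x. count V x div m)"
    by (simp add: Abs_multiset_inverse)
  then have "V = repeat_mset m (Abs_multiset (\<lambda>x. count V x div m))"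
    using assms by (auto simp: multiset_eq_iff)
  then show ?thesis by blast
qed

text \<open>Mere domination of \<open>W i\<close> by \<open>W j\<close> would not be enough later.
  With \<open>m = order G\<close> the difference, being an \<open>m\<close>-fold repetition, is
  product-one.\<close>

lemma dickson_multisets:
  fixes W :: "nat \<Rightarrow> 'a multiset"
  assumes "finite A" and "\<And>i. set_mset (W i) \<subseteq> A" and "m > 0"
  shows "\<exists>i j U. i < j \<and> set_mset U \<subseteq> A \<and> W j = W i + repeat_mset m U"
proof -
  \<comment> \<open>Recording both the residue \<open>c mod m\<close> and \<open>m - c mod m\<close> forces equal residues.\<close>
  define f where "f i = (\<lambda>(a, k::nat). if k = 0 then count (W i) a
     else if k = 1 then count (W i) a mod m else m - count (W i) a mod m)" for i
  have fin: "finite (A \<times> {0, 1, 2 :: nat})" using assms(1) by simp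
  obtain r :: "nat \<Rightarrow> nat" where r: "strict_mono r"
    "\<And>p i j. p \<in> A \<times> {0, 1, 2} \<Longrightarrow> i \<le> j \<Longrightarrow> f (r i) p \<le> f (r j) p"
    using dickson_subsequence[OF fin, of f] by blast
  let ?i = "r 0" and ?j = "r 1"
  have eq: "count (W ?i) a \<le> count (W ?j) a \<and> count (W ?i) a mod m = count (W ?j) a mod m" for a
  proof (cases "a \<in> A")
    case True
    \<comment> \<open>The bounds rule out truncation in \<open>m - c mod m\<close>, so the reversed
      inequality between the residues can be read off.\<close>
    have "count (W ?i) a mod m < m" "count (W ?j) a mod m < m" using assms(3) by auto
    moreover have "count (W ?i) a \<le> count (W ?j) a" "count (W ?i) a mod m \<le> count (W ?j) a mod m"
      "m - count (W ?i) a mod m \<le> m - count (W ?j) a mod m"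
      using r(2)[of "(a, 0)" 0 1] r(2)[of "(a, 1)" 0 1] r(2)[of "(a, 2)" 0 1] True
      by (simp_all add: f_def)
    ultimately show ?thesis by linarith
  next
    case False
    then show ?thesis using assms(2) by (metis count_inI order_refl subsetD)
  qed
  have "m dvd count (W ?j - W ?i) a" for a
    using eq[of a] mod_eq_dvd_iff_nat[of "count (W ?i) a" "count (W ?j) a" m] by simp
  then obtain U where U: "W ?j - W ?i = repeat_mset m U"
    using repeat_mset_of_dvd_count assms(3) by blast
  have "W ?i \<subseteq># W ?j" using eq by (simp add: subseteq_mset_def)
  then have W: "W ?j = W ?i + repeat_mset m U" using U by (metis subset_mset.add_diff_inverse)
  have "set_mset U \<subseteq> A"
  proof
    fix x assume "x \<in># U"
    then have "count (repeat_mset m U) x > 0" using assms(3) by simp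
    then have "x \<in># repeat_mset m U" by (simp only: count_greater_zero_iff)
    then show "x \<in> A" using W assms(2)[of ?j] by auto
  qed
  moreover have "?i < ?j" using r(1) by (simp add: strict_mono_less)
  ultimately show ?thesis using W by blast
qed


section \<open>Maximal subgroups of a commutative semigroup with identity\<close>

context comm_monoid
begin

text \<open>Equality of the two translates reduces to membership of one generator in the other
  translate: \<open>x\<close> in the translate of \<open>e\<close> means that \<open>e\<close> fixes
  \<open>x\<close>, and \<open>e\<close> in the translate of \<open>x\<close> provides
  \<open>y\<close>. The witness \<open>y\<close> may lie outside the class of
  \<open>e\<close>.\<close>

lemma green_H_idempotent_iff:
  assumes e: "e \<in> idempotents G"
  shows "x \<in> green_H G e \<longleftrightarrow> x \<in> carrier G \<and> x \<otimes> e = x \<and> (\<exists>y\<in>carrier G. x \<otimes> y = e)"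
proof -
  have ec: "e \<in> carrier G" "e \<otimes> e = e" using e by (auto simp: idempotents_def)
  have "translate G e = translate G x" if x: "x \<in> carrier G" "x \<otimes> e = x" "y \<in> carrier G" "x \<otimes> y = e" for y
  proof -
    have "e \<otimes> c = x \<otimes> (y \<otimes> c)" if "c \<in> carrier G" for c
      using x that m_assoc by metis
    moreover have "x \<otimes> c = e \<otimes> (x \<otimes> c)" if "c \<in> carrier G" for c
      using x that ec m_assoc m_comm by metis
    ultimately show ?thesis unfolding translate_def using x by blast
  qed
  moreover have "x \<otimes> e = x \<and> (\<exists>y\<in>carrier G. x \<otimes> y = e)"
    if x: "x \<in> carrier G" and t: "translate G e = translate G x"
  proof -
    have "e \<otimes> e \<in> translate G e" "x \<otimes> \<one> \<in> translate G x"
      unfolding translate_def using ec x by blast+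
    then have "e \<in> translate G x" "x \<in> translate G e" using ec x t by auto
    then obtain y z where yz: "y \<in> carrier G" "z \<in> carrier G" "e = x \<otimes> y" "x = e \<otimes> z"
      unfolding translate_def by blast
    have "x \<otimes> e = e \<otimes> e \<otimes> z" unfolding yz(4) using ec(1) yz(2) by (simp add: m_ac)
    then have "x \<otimes> e = x" unfolding ec(2) yz(4)[symmetric] .
    with yz show ?thesis by metis
  qed
  ultimately show ?thesis by (auto simp: green_H_def)
qed

lemma green_H_idempotentE:
  assumes "e \<in> idempotents G" and "a \<in> green_H G e"
  obtains y where "a \<in> carrier G" "a \<otimes> e = a" "y \<in> carrier G" "a \<otimes> y = e"
  using assms green_H_idempotent_iff by blast

lemma group_H_group:
  assumes e: "e \<in> idempotents G"
  shows "group (H_group G e)"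
proof (rule groupI)
  note iff = green_H_idempotent_iff[OF e]
  have ec: "e \<in> carrier G" "e \<otimes> e = e" using e by (auto simp: idempotents_def)
  show "\<one>\<^bsub>H_group G e\<^esub> \<in> carrier (H_group G e)"
    using ec by (auto simp: H_group_def iff)
  fix x assume "x \<in> carrier (H_group G e)"
  then have x: "x \<in> carrier G" "x \<otimes> e = x" and "\<exists>y\<in>carrier G. x \<otimes> y = e"
    by (auto simp: H_group_def iff)
  then obtain y where y: "y \<in> carrier G" "x \<otimes> y = e" by blast
  show "\<one>\<^bsub>H_group G e\<^esub> \<otimes>\<^bsub>H_group G e\<^esub> x = x"
    using x ec m_comm by (simp add: H_group_def)
  \<comment> \<open>\<open>y\<close> inverts \<open>x\<close> only within the whole semigroup;
    multiplying by \<open>e\<close> moves it into the class of \<open>e\<close>.\<close>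
  have "(y \<otimes> e) \<otimes> x = e" "(y \<otimes> e) \<otimes> e = y \<otimes> e"
    using x y ec m_assoc m_comm m_closed by metis+
  then have "y \<otimes> e \<in> green_H G e" "(y \<otimes> e) \<otimes> x = e"
    using x y ec by (auto simp: iff)
  then show "\<exists>y\<in>carrier (H_group G e). y \<otimes>\<^bsub>H_group G e\<^esub> x = \<one>\<^bsub>H_group G e\<^esub>"
    by (auto simp: H_group_def)
  fix z assume "z \<in> carrier (H_group G e)"
  then have z: "z \<in> carrier G" "z \<otimes> e = z" and "\<exists>y\<in>carrier G. z \<otimes> y = e"
    by (auto simp: H_group_def iff)
  then obtain w where w: "w \<in> carrier G" "z \<otimes> w = e" by blast
  have "(x \<otimes> z) \<otimes> (y \<otimes> w) = (x \<otimes> y) \<otimes> (z \<otimes> w)"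
    using x(1) y(1) z(1) w(1) by (simp add: m_ac)
  also have "\<dots> = e" using y w ec by simp
  finally have "(x \<otimes> z) \<otimes> (y \<otimes> w) = e" .
  moreover have "(x \<otimes> z) \<otimes> e = x \<otimes> z" using x z ec by (simp add: m_assoc)
  ultimately show "x \<otimes>\<^bsub>H_group G e\<^esub> z \<in> carrier (H_group G e)"
    using x y z w by (auto simp: H_group_def iff)
  fix v assume "v \<in> carrier (H_group G e)"
  then have "v \<in> carrier G" by (auto simp: H_group_def iff)
  with x z show "(x \<otimes>\<^bsub>H_group G e\<^esub> z) \<otimes>\<^bsub>H_group G e\<^esub> v = x \<otimes>\<^bsub>H_group G e\<^esub> (z \<otimes>\<^bsub>H_group G e\<^esub> v)"
    by (simp add: H_group_def m_assoc)
qed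

text \<open>Any subgroup through \<open>a\<close> with identity \<open>e\<close> consists of
  elements fixed by \<open>e\<close> and invertible up to \<open>e\<close>, so it sits inside the
  H-class of \<open>e\<close>. Hence the subgroup can always be taken to be the maximal one.\<close>

lemma clifford_iff:
  "clifford G \<longleftrightarrow> (\<forall>a\<in>carrier G. \<exists>e\<in>idempotents G. a \<in> green_H G e)"
proof
  assume "clifford G"
  show "\<forall>a\<in>carrier G. \<exists>e\<in>idempotents G. a \<in> green_H G e"
  proof
    fix a assume a: "a \<in> carrier G"
    then obtain K e where K: "a \<in> K" "K \<subseteq> carrier G" "group (G\<lparr>carrier := K, one := e\<rparr>)"
      using \<open>clifford G\<close> by (auto simp: clifford_def)
    interpret K: group "G\<lparr>carrier := K, one := e\<rparr>" by (rule K)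
    have e: "e \<in> K" "e \<otimes> e = e" "a \<otimes> e = a"
      using K.one_closed K.l_one[of e] K.r_one[of a] K by auto
    obtain y where "y \<in> K" "a \<otimes> y = e" using K.r_inv_ex[of a] K(1) by auto
    moreover have "e \<in> idempotents G" using e K by (auto simp: idempotents_def)
    ultimately show "\<exists>e\<in>idempotents G. a \<in> green_H G e"
      using green_H_idempotent_iff e a K by blast
  qed
next
  assume *: "\<forall>a\<in>carrier G. \<exists>e\<in>idempotents G. a \<in> green_H G e"
  show "clifford G"
    unfolding clifford_def
  proof
    fix a assume "a \<in> carrier G"
    then obtain e where e: "e \<in> idempotents G" "a \<in> green_H G e" using * by blast
    have "green_H G e \<subseteq> carrier G" by (auto simp: green_H_def)
    with e group_H_group[OF e(1)]
    show "\<exists>K e. a \<in> K \<and> K \<subseteq> carrier G \<and> group (G\<lparr>carrier := K, one := e\<rparr>)"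
      by (auto simp: H_group_def)
  qed
qed

text \<open>A group has only one idempotent, its identity. The computation cancels one of the two
  factors in \<open>a [^] k \<otimes> a [^] k\<close> by means of \<open>y [^] k\<close>.\<close>

lemma pow_idempotent_in_green_H:
  assumes e: "e \<in> idempotents G" and a: "a \<in> green_H G e"
    and k: "k > 0" "a [^] (k::nat) \<in> idempotents G"
  shows "a [^] k = e"
proof -
  have ec: "e \<in> carrier G" "e \<otimes> e = e" using e by (auto simp: idempotents_def)
  obtain y where y: "a \<in> carrier G" "a \<otimes> e = a" "y \<in> carrier G" "a \<otimes> y = e"
    using green_H_idempotentE[OF e a] by blast
  \<comment> \<open>Only positive powers of \<open>e\<close> are \<open>e\<close>: the zeroth power
    is the identity of the whole semigroup.\<close>
  have epow: "e [^] Suc j = e" for j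
    using ec by (induction j) auto
  obtain j where j: "k = Suc j" using k gr0_conv_Suc by blast
  have "a [^] k \<otimes> y [^] k = (a \<otimes> y) [^] k"
    using y pow_mult_distrib[of a y k] m_comm[of a y] by metis
  also have "\<dots> = e" using y epow j by simp
  finally have 1: "a [^] k \<otimes> y [^] k = e" .
  have 2: "a [^] k \<otimes> e = a [^] k"
    using y ec unfolding j by (simp add: m_assoc)
  have 3: "a [^] k \<otimes> a [^] k = a [^] k" using k(2) by (simp add: idempotents_def)
  have "e = (a [^] k \<otimes> a [^] k) \<otimes> y [^] k" using 1 3 by simp
  also have "\<dots> = a [^] k \<otimes> e" using 1 y by (simp add: m_assoc)
  finally show ?thesis using 2 by simp
qed

text \<open>With \<open>y\<close> inverting \<open>a\<close> up to \<open>e\<close>, the product of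
  \<open>a \<otimes> f\<close> and \<open>y\<close> is \<open>f \<otimes> e\<close>, which is
  \<open>f\<close> when \<open>f\<close> lies below \<open>e\<close>. Conversely \<open>a\<close>
  absorbs \<open>e\<close>, so an \<open>f\<close> that can be recovered from
  \<open>a \<otimes> f\<close> absorbs \<open>e\<close> as well.\<close>

lemma rees_le_iff_mult_green_H:
  assumes e: "e \<in> idempotents G" and f: "f \<in> idempotents G" and a: "a \<in> green_H G e"
  shows "rees_le G f e \<longleftrightarrow> a \<otimes> f \<in> green_H G f"
proof -
  have ec: "e \<in> carrier G" "e \<otimes> e = e" "f \<in> carrier G" "f \<otimes> f = f"
    using e f by (auto simp: idempotents_def)
  obtain y where y: "a \<in> carrier G" "a \<otimes> e = a" "y \<in> carrier G" "a \<otimes> y = e"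
    using green_H_idempotentE[OF e a] by blast
  have cl: "a \<otimes> f \<otimes> f = a \<otimes> f" using y ec by (simp add: m_assoc)
  show ?thesis
  proof
    assume "rees_le G f e"
    then have fe: "f \<otimes> e = f" by (simp add: rees_le_def)
    have "a \<otimes> f \<otimes> y = f \<otimes> (a \<otimes> y)"
      using y(1,3) ec(3) by (metis m_assoc m_comm)
    then have "a \<otimes> f \<otimes> y = f" using y fe by simp
    then show "a \<otimes> f \<in> green_H G f" using cl y ec by (auto simp: green_H_idempotent_iff[OF f])
  next
    assume "a \<otimes> f \<in> green_H G f"
    then obtain z where z: "z \<in> carrier G" "a \<otimes> f \<otimes> z = f"
      by (rule green_H_idempotentE[OF f])
    have "a \<otimes> f \<otimes> z \<otimes> e = a \<otimes> e \<otimes> f \<otimes> z"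
      using y(1) ec(1,3) z(1) by (simp add: m_ac)
    then show "rees_le G f e" using y(2) z(2) by (simp add: rees_le_def)
  qed
qed

text \<open>Each \<open>a\<close> lies in the class of some idempotent \<open>f\<close>, and
  \<open>f\<close> is a multiple of \<open>a\<close>; if \<open>a\<close> absorbs \<open>e\<close>,
  so does \<open>f\<close>.\<close>

lemma translate_idempotent_eq_Union:
  assumes "clifford G" and e: "e \<in> idempotents G"
  shows "translate G e = (\<Union>f\<in>{f \<in> idempotents G. rees_le G f e}. green_H G f)"
proof (intro equalityI subsetI)
  have ec: "e \<in> carrier G" "e \<otimes> e = e" using e by (auto simp: idempotents_def)
  {
    fix a assume "a \<in> translate G e"
    then obtain c where c: "c \<in> carrier G" "a = e \<otimes> c" by (auto simp: translate_def)
    then have a: "a \<in> carrier G" "a \<otimes> e = a" using ec by (auto simp: m_ac)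
    then obtain f where f: "f \<in> idempotents G" "a \<in> green_H G f"
      using assms(1) by (auto simp: clifford_iff)
    then obtain y where y: "y \<in> carrier G" "a \<otimes> y = f" by (rule green_H_idempotentE)
    have "f \<otimes> e = (a \<otimes> e) \<otimes> y" using a y ec by (metis m_assoc m_comm)
    then have "rees_le G f e" using a y by (simp add: rees_le_def)
    then show "a \<in> (\<Union>f\<in>{f \<in> idempotents G. rees_le G f e}. green_H G f)" using f by blast
  next
    fix a assume "a \<in> (\<Union>f\<in>{f \<in> idempotents G. rees_le G f e}. green_H G f)"
    then obtain f where f: "f \<in> idempotents G" "f \<otimes> e = f" "a \<in> green_H G f"
      by (auto simp: rees_le_def)
    then have a: "a \<in> carrier G" "a \<otimes> f = a" "f \<in> carrier G"
      by (blast elim: green_H_idempotentE, blast elim: green_H_idempotentE, simp add: idempotents_def)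
    then have "a = e \<otimes> (f \<otimes> a)" using f ec by (metis m_assoc m_comm)
    then show "a \<in> translate G e" unfolding translate_def using a by blast
  }
qed

text \<open>Serves to find a nonzero coordinate in every tuple: at the idempotent of its own maximal
  subgroup, an element is a unit. The inverse is \<open>e \<otimes> y\<close>, since
  \<open>y\<close> itself may lie outside the translate.\<close>

lemma green_H_subset_Units_local_monoid:
  assumes e: "e \<in> idempotents G"
  shows "green_H G e \<subseteq> Units (local_monoid G e)"
proof
  fix a assume a: "a \<in> green_H G e"
  have ec: "e \<in> carrier G" "e \<otimes> e = e" using e by (auto simp: idempotents_def)
  obtain y where y: "a \<in> carrier G" "a \<otimes> e = a" "y \<in> carrier G" "a \<otimes> y = e"
    using green_H_idempotentE[OF e a] by blast
  have "a = e \<otimes> a" using y ec by (metis m_comm)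
  moreover have "a \<otimes> (e \<otimes> y) = e" "(e \<otimes> y) \<otimes> a = e"
    using y ec by (metis m_assoc m_comm m_closed)+
  ultimately show "a \<in> Units (local_monoid G e)"
    using y unfolding Units_def local_monoid_def translate_def by auto
qed

end


section \<open>Products of sequences and the class semigroup\<close>

lemma sequences_simps [simp]:
  "carrier (sequences G) = {S. set_mset S \<subseteq> carrier G}"
  "S \<otimes>\<^bsub>sequences G\<^esub> T = S + T"
  "\<one>\<^bsub>sequences G\<^esub> = {#}"
  by (auto simp: sequences_def)

lemma mem_product_one_iff [simp]:
  "S \<in> carrier (product_one G) \<longleftrightarrow> set_mset S \<subseteq> carrier G \<and> \<one>\<^bsub>G\<^esub> \<in> products G S"
  by (simp add: product_one_def sequences_def)

lemma product_one_simps [simp]: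
  "S \<otimes>\<^bsub>product_one G\<^esub> T = S + T"
  "\<one>\<^bsub>product_one G\<^esub> = {#}"
  by (auto simp: product_one_def sequences_def)

lemma set_mset_repeat_subset: "set_mset (repeat_mset n S) \<subseteq> set_mset S"
  by (induction n) auto

lemma (in monoid) foldr_mult_append:
  assumes "set xs \<subseteq> carrier G" and "set ys \<subseteq> carrier G"
  shows "foldr (\<otimes>) (xs @ ys) \<one> = foldr (\<otimes>) xs \<one> \<otimes> foldr (\<otimes>) ys \<one>"
  using assms by (induction xs) (auto simp: m_assoc)

context group
begin

lemma productsI: "mset xs = S \<Longrightarrow> p = foldr (\<otimes>) xs \<one> \<Longrightarrow> p \<in> products G S"
  by (auto simp: products_def)

lemma productsE:
  assumes "p \<in> products G S"
  obtains xs where "mset xs = S" "p = foldr (\<otimes>) xs \<one>"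
  using assms by (auto simp: products_def)

lemma products_closed:
  assumes "set_mset S \<subseteq> carrier G"
  shows "products G S \<subseteq> carrier G"
  using assms by (auto elim!: productsE)

lemma products_nonempty: "products G S \<noteq> {}"
  using productsI ex_mset by blast

lemma products_empty: "products G {#} = {\<one>}"
  by (auto simp: products_def)

lemma mem_products_singleton: "g \<in> carrier G \<Longrightarrow> g \<in> products G {#g#}"
  by (rule productsI[of "[g]"]) auto

lemma products_pair:
  assumes "g \<in> carrier G" and "h \<in> carrier G"
  shows "products G {#g, h#} \<subseteq> {g \<otimes> h, h \<otimes> g}"
proof
  fix p assume "p \<in> products G {#g, h#}"
  then obtain xs where xs: "mset xs = {#g, h#}" "p = foldr (\<otimes>) xs \<one>" by (rule productsE)
  then have "length xs = 2" by (metis size_mset size_add_mset size_empty numeral_2_eq_2)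
  then obtain a b where "xs = [a, b]" by (auto simp: length_Suc_conv numeral_2_eq_2)
  then have ab: "{#a, b#} = {#g, h#}" "p = a \<otimes> (b \<otimes> \<one>)" using xs by simp_all
  then have "a = g \<and> b = h \<or> a = h \<and> b = g"
    by (metis add_mset_commute add_mset_add_mset_same_iff insert_iff set_mset_add_mset_insert
        single_eq_single set_mset_empty empty_iff)
  then show "p \<in> {g \<otimes> h, h \<otimes> g}" using ab assms by auto
qed

lemma products_add:
  assumes "set_mset S \<subseteq> carrier G" and "set_mset T \<subseteq> carrier G"
    and "p \<in> products G S" and "q \<in> products G T"
  shows "p \<otimes> q \<in> products G (S + T)"
proof -
  obtain xs ys where *: "mset xs = S" "p = foldr (\<otimes>) xs \<one>" "mset ys = T" "q = foldr (\<otimes>) ys \<one>"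
    using assms(3,4) by (metis productsE)
  then have "set xs \<subseteq> carrier G" "set ys \<subseteq> carrier G" using assms(1,2) by auto
  then have "p \<otimes> q = foldr (\<otimes>) (xs @ ys) \<one>" using * foldr_mult_append by simp
  then show ?thesis using * by (intro productsI[of "xs @ ys"]) auto
qed

lemma product_one_add:
  assumes "S \<in> carrier (product_one G)" and "T \<in> carrier (product_one G)"
  shows "S + T \<in> carrier (product_one G)"
  using assms products_add[of S T \<one> \<one>] by simp

lemma product_one_empty: "{#} \<in> carrier (product_one G)"
  by (simp add: products_empty)

lemma product_one_repeat:
  assumes "S \<in> carrier (product_one G)"
  shows "repeat_mset n S \<in> carrier (product_one G)"
proof (induction n)
  case 0
  show ?case by (simp add: products_empty)
next
  case (Suc n)
  show ?case using product_one_add[OF assms Suc] by simp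
qed

text \<open>A product-one ordering may be rotated cyclically until a given term comes last.\<close>

lemma mem_products_iff:
  assumes "set_mset S \<subseteq> carrier G" and g: "g \<in> carrier G"
  shows "g \<in> products G S \<longleftrightarrow> S + {#inv g#} \<in> carrier (product_one G)"
proof
  assume "g \<in> products G S"
  then have "g \<otimes> inv g \<in> products G (S + {#inv g#})"
    using assms by (intro products_add mem_products_singleton) auto
  then show "S + {#inv g#} \<in> carrier (product_one G)" using assms by simp
next
  assume "S + {#inv g#} \<in> carrier (product_one G)"
  then have "\<one> \<in> products G (S + {#inv g#})" by simp
  then obtain xs where xs: "mset xs = S + {#inv g#}" "\<one> = foldr (\<otimes>) xs \<one>" by (rule productsE)
  then have "inv g \<in> set xs" by (metis mset_single_iff_right set_mset_mset union_iff union_single_eq_member add_mset_add_single)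
  then obtain us vs where uv: "xs = us @ inv g # vs" by (meson split_list)
  then have "mset (vs @ us) = S" using xs(1) by (simp add: add.commute)
  moreover from this have cl: "set us \<subseteq> carrier G" "set vs \<subseteq> carrier G" using assms(1) by auto
  define u v where "u = foldr (\<otimes>) us \<one>" and "v = foldr (\<otimes>) vs \<one>"
  have uvc: "u \<in> carrier G" "v \<in> carrier G" using cl by (auto simp: u_def v_def)
  have "u \<otimes> (inv g \<otimes> v) = \<one>"
    using xs(2) cl g unfolding uv u_def v_def by (subst (asm) foldr_mult_append) auto
  then have "inv g \<otimes> v = inv u" using uvc g by (metis inv_equality inv_inv m_closed inv_closed)
  then have "v = g \<otimes> inv u" using uvc g by (metis inv_closed inv_solve_left)
  then have "v \<otimes> u = g" using uvc g by (simp add: m_assoc)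
  then have "g = foldr (\<otimes>) (vs @ us) \<one>" using cl foldr_mult_append by (simp add: u_def v_def)
  ultimately show "g \<in> products G S" by (intro productsI)
qed

section \<open>The class congruence and the semigroup of classes\<close>

lemma seq_class_eq_iff:
  assumes "set_mset S \<subseteq> carrier G" and "set_mset T \<subseteq> carrier G"
  shows "seq_class G S = seq_class G T \<longleftrightarrow> (\<forall>W. set_mset W \<subseteq> carrier G \<longrightarrow>
    (S + W \<in> carrier (product_one G) \<longleftrightarrow> T + W \<in> carrier (product_one G)))" (is "_ \<longleftrightarrow> ?R")
proof
  assume "seq_class G S = seq_class G T"
  moreover have "T \<in> seq_class G T"
    using assms by (auto simp: congruence_class_def class_congruence_def)
  ultimately have "T \<in> seq_class G S" by simp
  then show ?R by (auto simp: congruence_class_def class_congruence_def)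
next
  assume ?R
  then show "seq_class G S = seq_class G T"
    using assms by (auto simp: congruence_class_def class_congruence_def)
qed

lemma seq_class_self: "set_mset S \<subseteq> carrier G \<Longrightarrow> S \<in> seq_class G S"
  by (auto simp: congruence_class_def class_congruence_def)

lemma mem_seq_class_iff:
  "set_mset S \<subseteq> carrier G \<Longrightarrow>
    T \<in> seq_class G S \<longleftrightarrow> set_mset T \<subseteq> carrier G \<and> seq_class G S = seq_class G T"
  using seq_class_eq_iff[of S T] by (auto simp: congruence_class_def class_congruence_def)

text \<open>The summands are replaced one after the other, the remaining summand being absorbed into
  the test sequence.\<close>

lemma seq_class_add_cong:
  assumes "set_mset S \<subseteq> carrier G" "set_mset T \<subseteq> carrier G"
    and "set_mset S' \<subseteq> carrier G" "set_mset T' \<subseteq> carrier G"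
    and "seq_class G S = seq_class G S'" and "seq_class G T = seq_class G T'"
  shows "seq_class G (S + T) = seq_class G (S' + T')"
proof -
  have 1: "S + W \<in> carrier (product_one G) \<longleftrightarrow> S' + W \<in> carrier (product_one G)"
    if "set_mset W \<subseteq> carrier G" for W
    using assms seq_class_eq_iff that by blast
  have 2: "T + W \<in> carrier (product_one G) \<longleftrightarrow> T' + W \<in> carrier (product_one G)"
    if "set_mset W \<subseteq> carrier G" for W
    using assms seq_class_eq_iff that by blast
  have "S + T + W \<in> carrier (product_one G) \<longleftrightarrow> S' + T' + W \<in> carrier (product_one G)"
    if W: "set_mset W \<subseteq> carrier G" for W
  proof -
    have "S + T + W \<in> carrier (product_one G) \<longleftrightarrow> S' + (T + W) \<in> carrier (product_one G)"
      using 1[of "T + W"] assms W by (simp add: add.assoc)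
    also have "\<dots> \<longleftrightarrow> T + (S' + W) \<in> carrier (product_one G)" by (simp add: add_ac)
    also have "\<dots> \<longleftrightarrow> T' + (S' + W) \<in> carrier (product_one G)"
      by (rule 2) (use assms W in auto)
    finally show ?thesis by (simp add: add_ac)
  qed
  then show ?thesis using assms by (subst seq_class_eq_iff) auto
qed

lemma carrier_seq_class_semigroup:
  "carrier (seq_class_semigroup G) = seq_class G ` {S. set_mset S \<subseteq> carrier G}"
  by (simp add: class_semigroup_def)

lemma one_seq_class_semigroup: "\<one>\<^bsub>seq_class_semigroup G\<^esub> = seq_class G {#}"
  by (simp add: class_semigroup_def)

text \<open>The product of classes is a union over all pairs of representatives. By the congruence
  property all members of this union coincide, and there is at least one pair.\<close>

lemma mult_seq_class_semigroup:
  assumes "set_mset S \<subseteq> carrier G" and "set_mset T \<subseteq> carrier G"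
  shows "seq_class G S \<otimes>\<^bsub>seq_class_semigroup G\<^esub> seq_class G T = seq_class G (S + T)"
proof -
  have "seq_class G (S' + T') = seq_class G (S + T)"
    if "S' \<in> seq_class G S" "T' \<in> seq_class G T" for S' T'
    using that assms seq_class_add_cong mem_seq_class_iff by metis
  then have "(\<Union>S'\<in>seq_class G S. \<Union>T'\<in>seq_class G T. seq_class G (S' + T')) =
    (\<Union>S'\<in>seq_class G S. \<Union>T'\<in>seq_class G T. seq_class G (S + T))"
    by (intro SUP_cong refl)
  also have "\<dots> = seq_class G (S + T)"
    using seq_class_self[OF assms(1)] seq_class_self[OF assms(2)] by blast
  finally show ?thesis by (simp add: class_semigroup_def)
qed

lemma comm_monoid_seq_class_semigroup: "comm_monoid (seq_class_semigroup G)"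
proof (rule comm_monoidI)
  let ?C = "seq_class_semigroup G"
  show "\<one>\<^bsub>?C\<^esub> \<in> carrier ?C" by (auto simp: one_seq_class_semigroup carrier_seq_class_semigroup)
  fix x assume "x \<in> carrier ?C"
  then obtain S where S: "x = seq_class G S" "set_mset S \<subseteq> carrier G"
    by (auto simp: carrier_seq_class_semigroup)
  show "\<one>\<^bsub>?C\<^esub> \<otimes>\<^bsub>?C\<^esub> x = x"
    using S by (simp add: one_seq_class_semigroup mult_seq_class_semigroup)
  fix y assume "y \<in> carrier ?C"
  then obtain T where T: "y = seq_class G T" "set_mset T \<subseteq> carrier G"
    by (auto simp: carrier_seq_class_semigroup)
  show "x \<otimes>\<^bsub>?C\<^esub> y \<in> carrier ?C"
    using S T by (auto simp: mult_seq_class_semigroup carrier_seq_class_semigroup)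
  show "x \<otimes>\<^bsub>?C\<^esub> y = y \<otimes>\<^bsub>?C\<^esub> x"
    using S T by (simp add: mult_seq_class_semigroup add.commute)
  fix z assume "z \<in> carrier ?C"
  then obtain U where U: "z = seq_class G U" "set_mset U \<subseteq> carrier G"
    by (auto simp: carrier_seq_class_semigroup)
  show "x \<otimes>\<^bsub>?C\<^esub> y \<otimes>\<^bsub>?C\<^esub> z = x \<otimes>\<^bsub>?C\<^esub> (y \<otimes>\<^bsub>?C\<^esub> z)"
    using S T U by (simp add: mult_seq_class_semigroup add.assoc)
qed

lemma pow_seq_class:
  assumes "set_mset S \<subseteq> carrier G"
  shows "seq_class G S [^]\<^bsub>seq_class_semigroup G\<^esub> n = seq_class G (repeat_mset n S)"
proof (induction n)
  case 0
  show ?case by (simp add: one_seq_class_semigroup)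
next
  case (Suc n)
  have "set_mset (repeat_mset n S) \<subseteq> carrier G"
    using set_mset_repeat_subset assms by (rule subset_trans)
  then show ?case using assms by (simp add: Suc mult_seq_class_semigroup add.commute)
qed

text \<open>The single term \<open>inv g\<close> is a test sequence that detects whether
  \<open>g\<close> is a product.\<close>

lemma products_eq_if_seq_class_eq:
  assumes "set_mset S \<subseteq> carrier G" and "set_mset T \<subseteq> carrier G" and "seq_class G S = seq_class G T"
  shows "products G S = products G T"
proof -
  have "g \<in> products G S \<longleftrightarrow> g \<in> products G T" if g: "g \<in> carrier G" for g
  proof -
    have "set_mset {#inv g#} \<subseteq> carrier G" using g by simp
    then have "S + {#inv g#} \<in> carrier (product_one G) \<longleftrightarrow> T + {#inv g#} \<in> carrier (product_one G)"
      using seq_class_eq_iff[OF assms(1,2)] assms(3) by blast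
    then show ?thesis unfolding mem_products_iff[OF assms(1) g] mem_products_iff[OF assms(2) g] .
  qed
  then show ?thesis using products_closed[OF assms(1)] products_closed[OF assms(2)] by blast
qed

lemma class_products_seq_class:
  assumes "set_mset S \<subseteq> carrier G"
  shows "class_products G (seq_class G S) = products G S"
proof -
  have "products G T = products G S" if "T \<in> seq_class G S" for T
    using that products_eq_if_seq_class_eq[OF assms, of T] by (simp add: mem_seq_class_iff[OF assms])
  then have "products G ` seq_class G S = {products G S}"
    using seq_class_self[OF assms] by blast
  then show ?thesis by (simp add: class_products_def)
qed

end


section \<open>Seminormality and the Clifford property\<close>

declare mem_product_one_iff [simp del]

context group
begin

lemma seq_class_eqD:
  assumes "seq_class G S = seq_class G T"
    and "set_mset S \<subseteq> carrier G" "set_mset T \<subseteq> carrier G" "set_mset W \<subseteq> carrier G"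
  shows "S + W \<in> carrier (product_one G) \<longleftrightarrow> T + W \<in> carrier (product_one G)"
  using seq_class_eq_iff[OF assms(2,3)] assms(1,4) by blast

lemma product_one_seq_class_cong:
  assumes "seq_class G S = seq_class G T" and "set_mset S \<subseteq> carrier G" "set_mset T \<subseteq> carrier G"
  shows "S \<in> carrier (product_one G) \<longleftrightarrow> T \<in> carrier (product_one G)"
  using seq_class_eqD[OF assms, of "{#}"] by simp

lemma pow_mem_products_replicate: "g \<in> carrier G \<Longrightarrow> g [^] n \<in> products G (replicate_mset n g)"
proof (induction n)
  case 0
  show ?case by (simp add: products_empty)
next
  case (Suc n)
  have "set_mset (replicate_mset n g) \<subseteq> carrier G" using Suc.prems by (auto split: if_splits)
  moreover have "set_mset {#g#} \<subseteq> carrier G" using Suc.prems by simp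
  moreover have "g [^] n \<in> products G (replicate_mset n g)" using Suc by blast
  ultimately have "g [^] n \<otimes> g \<in> products G (replicate_mset n g + {#g#})"
    using mem_products_singleton[OF Suc.prems] by (rule products_add)
  then show ?case by simp
qed

text \<open>By Lagrange, each term repeated \<open>order G\<close> times multiplies to the identity,
  and product-one blocks may be concatenated.\<close>

lemma repeat_order_product_one:
  assumes "finite (carrier G)" and "set_mset S \<subseteq> carrier G" and "order G dvd m"
  shows "repeat_mset m S \<in> carrier (product_one G)"
proof -
  have "repeat_mset (order G) S \<in> carrier (product_one G)"
    using assms(2)
  proof (induction S)
    case empty
    show ?case by (simp add: product_one_empty)
  next
    case (add x S)
    then have x: "x \<in> carrier G" by simp
    have "\<one> \<in> products G (replicate_mset (order G) x)"
      using pow_mem_products_replicate[OF x, of "order G"] pow_order_eq_1[OF x] by simp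
    then have "replicate_mset (order G) x \<in> carrier (product_one G)"
      using x by (auto simp: mem_product_one_iff split: if_splits)
    moreover have "repeat_mset (order G) S \<in> carrier (product_one G)"
      using add by simp
    ultimately show ?case
      unfolding repeat_mset_distrib_add_mset by (rule product_one_add)
  qed
  moreover obtain j where "m = j * order G" using assms(3) by (metis dvd_def mult.commute)
  ultimately show ?thesis
    using product_one_repeat[of "repeat_mset (order G) S" j] by (simp only: repeat_mset_right)
qed

lemma repeat_closed: "set_mset S \<subseteq> carrier G \<Longrightarrow> set_mset (repeat_mset n S) \<subseteq> carrier G"
  using set_mset_repeat_subset by (rule subset_trans)

lemma seq_class_closed: "set_mset S \<subseteq> carrier G \<Longrightarrow> seq_class G S \<in> carrier (seq_class_semigroup G)"
  by (auto simp: carrier_seq_class_semigroup)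

lemma seq_class_idempotent_iff:
  assumes "set_mset S \<subseteq> carrier G"
  shows "seq_class G S \<in> idempotents (seq_class_semigroup G) \<longleftrightarrow> seq_class G (S + S) = seq_class G S"
  using assms seq_class_closed by (simp add: idempotents_def mult_seq_class_semigroup)

text \<open>The sets \<open>{W. repeat_mset (n * order G) S + W \<in> \<B>(G)}\<close> increase with \<open>n\<close>
  and are closed under adding \<open>order G\<close>-fold repetitions, so by Dickson's lemma they stabilise.\<close>

lemma ex_repeat_idempotent:
  assumes fin: "finite (carrier G)" and S: "set_mset S \<subseteq> carrier G"
  shows "\<exists>k>0. order G dvd k \<and> seq_class G (repeat_mset k S) \<in> idempotents (seq_class_semigroup G)"
proof (rule ccontr)
  assume contr: "\<not> ?thesis"
  define P where "P n W \<longleftrightarrow> repeat_mset (n * order G) S + W \<in> carrier (product_one G)" for n W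
  have pos: "order G > 0" using fin order_gt_0_iff_finite by blast
  have mono: "P n W" if "P m W" "m \<le> n" for m n W
  proof -
    have "repeat_mset ((n - m) * order G) S \<in> carrier (product_one G)"
      by (rule repeat_order_product_one[OF fin S]) simp
    then have "repeat_mset ((n - m) * order G) S + (repeat_mset (m * order G) S + W) \<in> carrier (product_one G)"
      using that(1) unfolding P_def by (rule product_one_add)
    moreover have "n * order G = (n - m) * order G + m * order G"
      using that(2) by (simp flip: add_mult_distrib)
    ultimately show ?thesis unfolding P_def by (metis add.assoc repeat_mset_distrib)
  qed
  \<comment> \<open>A non-idempotent class separates level \<open>n\<close> from level
    \<open>2 * n\<close>. By monotonicity the separating \<open>W\<close> can only be missing at
    level \<open>n\<close> and present at level \<open>2 * n\<close>.\<close>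
  have "\<exists>W. set_mset W \<subseteq> carrier G \<and> \<not> P n W \<and> P (2 * n) W" if n: "n > 0" for n
  proof -
    let ?R = "repeat_mset (n * order G) S"
    have R: "set_mset ?R \<subseteq> carrier G" by (rule repeat_closed[OF S])
    have "seq_class G ?R \<notin> idempotents (seq_class_semigroup G)"
      using contr n pos by (metis dvd_triv_right nat_0_less_mult_iff)
    then have "seq_class G (?R + ?R) \<noteq> seq_class G ?R"
      using seq_class_idempotent_iff[OF R] by simp
    then obtain W where W: "set_mset W \<subseteq> carrier G"
      "(?R + ?R + W \<in> carrier (product_one G)) \<noteq> (?R + W \<in> carrier (product_one G))"
      using R seq_class_eq_iff[of "?R + ?R" ?R] by auto
    moreover have "?R + ?R = repeat_mset (2 * n * order G) S"
      by (simp add: multiset_eq_iff)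
    ultimately have "P (2 * n) W \<noteq> P n W" by (simp add: P_def)
    then show ?thesis using W(1) mono[of n W "2 * n"] by auto
  qed
  then obtain W where W: "\<And>n. n > 0 \<Longrightarrow> set_mset (W n) \<subseteq> carrier G"
    "\<And>n. n > 0 \<Longrightarrow> \<not> P n (W n)" "\<And>n. n > 0 \<Longrightarrow> P (2 * n) (W n)" by metis
  \<comment> \<open>Levels are sampled at powers of two, so that \<open>i < j\<close> puts level
    \<open>2 ^ j\<close> at or above the doubled level \<open>2 * 2 ^ i\<close>, where
    \<open>W (2 ^ i)\<close> is already present. Adding the product-one difference then puts
    \<open>W (2 ^ j)\<close> into its own level.\<close>
  then obtain i j U where ij: "i < j" "set_mset U \<subseteq> carrier G"
    "W (2 ^ j) = W (2 ^ i) + repeat_mset (order G) U"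
    using dickson_multisets[OF fin, of "\<lambda>i. W (2 ^ i)" "order G"] pos by auto
  have "(2::nat) * 2 ^ i \<le> 2 ^ j"
    using ij(1) power_increasing[of "Suc i" j "2::nat"] by simp
  then have "P (2 ^ j) (W (2 ^ i))" using W(3)[of "2 ^ i"] mono by simp
  moreover have "repeat_mset (order G) U \<in> carrier (product_one G)"
    by (rule repeat_order_product_one[OF fin ij(2)]) simp
  ultimately have "P (2 ^ j) (W (2 ^ j))"
    unfolding P_def ij(3) by (metis product_one_add add.assoc)
  then show False using W(2)[of "2 ^ j"] by simp
qed

lemma seq_class_repeat_mult:
  assumes S: "set_mset S \<subseteq> carrier G" and "j > 0"
    and "seq_class G (repeat_mset k S) \<in> idempotents (seq_class_semigroup G)"
  shows "seq_class G (repeat_mset (j * k) S) = seq_class G (repeat_mset k S)"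
  using assms(2)
proof (induction j rule: nat_induct_non_zero)
  case 1
  show ?case by simp
next
  case (Suc j)
  have idem: "seq_class G (repeat_mset k S + repeat_mset k S) = seq_class G (repeat_mset k S)"
    using assms(3) seq_class_idempotent_iff repeat_closed S by blast
  have "seq_class G (repeat_mset k S + repeat_mset (j * k) S) = seq_class G (repeat_mset k S + repeat_mset k S)"
    by (rule seq_class_add_cong) (simp_all only: repeat_closed S Suc.IH)
  with idem show ?case by (simp only: mult_Suc repeat_mset_distrib)
qed

text \<open>The class of \<open>T\<close> lies in some maximal subgroup; its idempotent power must
  be the identity of that subgroup and therefore fixes it.\<close>

lemma clifford_seq_class_Suc:
  assumes "clifford (seq_class_semigroup G)" and T: "set_mset T \<subseteq> carrier G" and "k > 0"
    and idem: "seq_class G (repeat_mset k T) \<in> idempotents (seq_class_semigroup G)"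
  shows "seq_class G (repeat_mset (Suc k) T) = seq_class G T"
proof -
  interpret C: comm_monoid "seq_class_semigroup G" by (rule comm_monoid_seq_class_semigroup)
  obtain e where e: "e \<in> idempotents (seq_class_semigroup G)"
    "seq_class G T \<in> green_H (seq_class_semigroup G) e"
    using assms(1) C.clifford_iff seq_class_closed[OF T] by blast
  have "seq_class G (repeat_mset k T) = e"
    using C.pow_idempotent_in_green_H[OF e \<open>k > 0\<close>] idem pow_seq_class[OF T] by simp
  moreover have "seq_class G T \<otimes>\<^bsub>seq_class_semigroup G\<^esub> e = seq_class G T"
    using e C.green_H_idempotent_iff by blast
  ultimately have "seq_class G (T + repeat_mset k T) = seq_class G T"
    using mult_seq_class_semigroup[OF T repeat_closed[OF T]] by metis
  then show ?thesis by simp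
qed

section \<open>Fractions of product-one sequences and seminormality\<close>

lemma fraction_eq_iff:
  assumes "a \<in> carrier (product_one G)" "b \<in> carrier (product_one G)"
    and "c \<in> carrier (product_one G)" "d \<in> carrier (product_one G)"
  shows "fraction (product_one G) a b = fraction (product_one G) c d \<longleftrightarrow> a + d = c + b"
proof
  assume "fraction (product_one G) a b = fraction (product_one G) c d"
  moreover have "(c, d) \<in> fraction (product_one G) c d"
    using assms by (auto simp: fraction_def fraction_rel_def)
  ultimately have "(c, d) \<in> fraction (product_one G) a b" by simp
  then show "a + d = c + b" by (simp add: fraction_def fraction_rel_def)
next
  assume eq: "a + d = c + b"
  \<comment> \<open>Transitivity of cross-multiplication: both sides are enlarged until the
    hypothesis can be substituted, then multiset cancellation removes the surplus.\<close>
  have "a + y = x + b \<longleftrightarrow> c + y = x + d" for x y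
  proof
    assume "a + y = x + b"
    then have "(c + y) + (a + b) = (x + d) + (a + b)" using eq by (metis add_ac)
    then show "c + y = x + d" by simp
  next
    assume "c + y = x + d"
    then have "(a + y) + (c + d) = (x + b) + (c + d)" using eq by (metis add_ac)
    then show "a + y = x + b" by simp
  qed
  then show "fraction (product_one G) a b = fraction (product_one G) c d"
    using assms by (auto simp: fraction_def fraction_rel_def)
qed

lemma mem_fraction_iff:
  assumes "a \<in> carrier (product_one G)" "b \<in> carrier (product_one G)"
  shows "(c, d) \<in> fraction (product_one G) a b \<longleftrightarrow>
    c \<in> carrier (product_one G) \<and> d \<in> carrier (product_one G) \<and> a + d = c + b"
  using assms by (auto simp: fraction_def fraction_rel_def)

text \<open>As with classes, the union over representatives collapses, because cross-multiplication
  shows that all of them yield the same fraction.\<close>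

lemma mult_fraction:
  assumes ab: "a \<in> carrier (product_one G)" "b \<in> carrier (product_one G)"
    and cd: "c \<in> carrier (product_one G)" "d \<in> carrier (product_one G)"
  shows "fraction (product_one G) a b \<otimes>\<^bsub>quotient_group (product_one G)\<^esub> fraction (product_one G) c d =
    fraction (product_one G) (a + c) (b + d)"
proof -
  have eq: "fraction (product_one G) (a' + c') (b' + d') = fraction (product_one G) (a + c) (b + d)"
    if "(a', b') \<in> fraction (product_one G) a b" "(c', d') \<in> fraction (product_one G) c d" for a' b' c' d'
  proof -
    have 1: "a' \<in> carrier (product_one G)" "b' \<in> carrier (product_one G)" "a + b' = a' + b"
      using that(1) by (simp_all only: mem_fraction_iff[OF ab])
    have 2: "c' \<in> carrier (product_one G)" "d' \<in> carrier (product_one G)" "c + d' = c' + d"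
      using that(2) by (simp_all only: mem_fraction_iff[OF cd])
    have "(a' + c') + (b + d) = (a' + b) + (c' + d)" by (simp only: add_ac)
    also have "\<dots> = (a + c) + (b' + d')" unfolding 1(3)[symmetric] 2(3)[symmetric] by (simp only: add_ac)
    finally have "(a' + c') + (b + d) = (a + c) + (b' + d')" .
    then show ?thesis
      by (subst fraction_eq_iff) (simp_all only: product_one_add 1 2 ab cd)
  qed
  have "fraction (product_one G) a b \<otimes>\<^bsub>quotient_group (product_one G)\<^esub> fraction (product_one G) c d =
    (\<Union>p\<in>fraction (product_one G) a b. \<Union>q\<in>fraction (product_one G) c d.
      fraction (product_one G) (fst p + fst q) (snd p + snd q))"
    by (simp add: quotient_group_def case_prod_unfold)
  also have "\<dots> = (\<Union>p\<in>fraction (product_one G) a b. \<Union>q\<in>fraction (product_one G) c d.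
      fraction (product_one G) (a + c) (b + d))"
    by (intro SUP_cong refl eq) simp_all
  also have "\<dots> = fraction (product_one G) (a + c) (b + d)"
  proof -
    have "(a, b) \<in> fraction (product_one G) a b" "(c, d) \<in> fraction (product_one G) c d"
      using ab cd by (simp_all only: mem_fraction_iff)
    then have "fraction (product_one G) a b \<noteq> {}" "fraction (product_one G) c d \<noteq> {}" by blast+
    then show ?thesis by simp
  qed
  finally show ?thesis .
qed

lemma pow_fraction:
  assumes "a \<in> carrier (product_one G)" "b \<in> carrier (product_one G)"
  shows "fraction (product_one G) a b [^]\<^bsub>quotient_group (product_one G)\<^esub> n =
    fraction (product_one G) (repeat_mset n a) (repeat_mset n b)"
proof (induction n)
  case 0
  show ?case by (simp add: nat_pow_def quotient_group_def)
next
  case (Suc n)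
  have "fraction (product_one G) a b [^]\<^bsub>quotient_group (product_one G)\<^esub> Suc n =
    fraction (product_one G) (repeat_mset n a) (repeat_mset n b) \<otimes>\<^bsub>quotient_group (product_one G)\<^esub>
      fraction (product_one G) a b"
    unfolding Suc.IH[symmetric] by (simp add: nat_pow_def)
  also have "\<dots> = fraction (product_one G) (repeat_mset n a + a) (repeat_mset n b + b)"
    by (rule mult_fraction) (simp_all only: product_one_repeat assms)
  finally show ?case by (simp add: add.commute)
qed

lemma comm_monoid_cancel_product_one: "comm_monoid_cancel (product_one G)"
proof (rule comm_monoid_cancelI)
  show "comm_monoid (product_one G)"
    by (rule comm_monoidI)
      (simp_all add: product_one_add product_one_empty ac_simps)
qed simp

text \<open>Eliminates the quotient group. An element whose square is a product-one sequence has
  nonnegative multiplicities, so it is a genuine sequence over G.\<close>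

lemma seminormal_product_one_iff:
  "seminormal (product_one G) \<longleftrightarrow> (\<forall>T. set_mset T \<subseteq> carrier G \<longrightarrow>
     repeat_mset 2 T \<in> carrier (product_one G) \<longrightarrow> repeat_mset 3 T \<in> carrier (product_one G) \<longrightarrow>
     T \<in> carrier (product_one G))"
proof
  let ?B = "product_one G"
  note e = product_one_empty
  {
    assume semi: "seminormal ?B"
    show "\<forall>T. set_mset T \<subseteq> carrier G \<longrightarrow> repeat_mset 2 T \<in> carrier ?B \<longrightarrow>
      repeat_mset 3 T \<in> carrier ?B \<longrightarrow> T \<in> carrier ?B"
    proof (intro allI impI)
      fix T assume T: "repeat_mset 2 T \<in> carrier ?B" "repeat_mset 3 T \<in> carrier ?B"
      \<comment> \<open>\<open>T\<close> is not yet known to be product-one, so it has to enter the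
        quotient group as the cube divided by the square.\<close>
      let ?x = "fraction ?B (repeat_mset 3 T) (repeat_mset 2 T)"
      have "fraction ?B (repeat_mset n (repeat_mset 3 T)) (repeat_mset n (repeat_mset 2 T)) =
        quotient_embed ?B (repeat_mset n T)" if "repeat_mset n T \<in> carrier ?B" for n
        unfolding quotient_embed_def product_one_simps(2)
        by (subst fraction_eq_iff)
          (use that T product_one_empty product_one_repeat[OF T(1), of n] product_one_repeat[OF T(2), of n]
            in \<open>simp_all add: multiset_eq_iff\<close>)
      then have "?x [^]\<^bsub>quotient_group ?B\<^esub> (2::nat) \<in> quotient_embed ?B ` carrier ?B"
        "?x [^]\<^bsub>quotient_group ?B\<^esub> (3::nat) \<in> quotient_embed ?B ` carrier ?B"
        using T by (simp_all only: pow_fraction image_eqI)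
      moreover have "?x \<in> carrier (quotient_group ?B)"
        unfolding quotient_group_def using T by fastforce
      ultimately obtain c where c: "c \<in> carrier ?B" "?x = fraction ?B c {#}"
        using semi unfolding seminormal_def quotient_embed_def product_one_simps(2) by blast
      then have "repeat_mset 3 T + {#} = c + repeat_mset 2 T"
        using fraction_eq_iff T e by blast
      then have "c = T" by (auto simp: multiset_eq_iff)
      with c show "T \<in> carrier ?B" by simp
    qed
  next
    assume *: "\<forall>T. set_mset T \<subseteq> carrier G \<longrightarrow> repeat_mset 2 T \<in> carrier ?B \<longrightarrow>
      repeat_mset 3 T \<in> carrier ?B \<longrightarrow> T \<in> carrier ?B"
    show "seminormal ?B"
      unfolding seminormal_def
    proof (intro conjI comm_monoid_cancel_product_one ballI impI, elim conjE)
      fix x assume "x \<in> carrier (quotient_group ?B)"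
        and 2: "x [^]\<^bsub>quotient_group ?B\<^esub> (2::nat) \<in> quotient_embed ?B ` carrier ?B"
        and 3: "x [^]\<^bsub>quotient_group ?B\<^esub> (3::nat) \<in> quotient_embed ?B ` carrier ?B"
      then obtain a b where ab: "a \<in> carrier ?B" "b \<in> carrier ?B" and x: "x = fraction ?B a b"
        by (auto simp: quotient_group_def)
      have embed: "\<exists>c. c \<in> carrier ?B \<and> repeat_mset n a = c + repeat_mset n b"
        if n: "x [^]\<^bsub>quotient_group ?B\<^esub> n \<in> quotient_embed ?B ` carrier ?B" for n :: nat
      proof -
        obtain c where c: "c \<in> carrier ?B"
          "fraction ?B (repeat_mset n a) (repeat_mset n b) = fraction ?B c {#}"
          using n unfolding x pow_fraction[OF ab] quotient_embed_def product_one_simps(2) by blast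
        then have "repeat_mset n a + {#} = c + repeat_mset n b"
          using fraction_eq_iff[of "repeat_mset n a" "repeat_mset n b" c "{#}"] product_one_repeat[OF ab(1)]
            product_one_repeat[OF ab(2)] e by blast
        with c show ?thesis by auto
      qed
      obtain c where c: "c \<in> carrier ?B" "repeat_mset 2 a = c + repeat_mset 2 b" using embed 2 by blast
      obtain d where d: "d \<in> carrier ?B" "repeat_mset 3 a = d + repeat_mset 3 b" using embed 3 by blast
      have c': "2 * count a y = count c y + 2 * count b y" for y
        using arg_cong[OF c(2), of "\<lambda>m. count m y"] by simp
      have d': "3 * count a y = count d y + 3 * count b y" for y
        using arg_cong[OF d(2), of "\<lambda>m. count m y"] by simp
      \<comment> \<open>The square alone forces the denominator to divide the numerator: twice the
        multiplicity in \<open>a\<close> is at least twice that in \<open>b\<close>.\<close>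
      have "b \<subseteq># a" using c' unfolding subseteq_mset_def by (metis add_leE le_add2 mult_le_cancel1 zero_less_numeral)
      then obtain T where T: "a = T + b" by (metis subset_mset.diff_add)
      have "c = repeat_mset 2 T" "d = repeat_mset 3 T"
        using c' d' unfolding T by (auto simp: multiset_eq_iff algebra_simps)
      moreover have "set_mset T \<subseteq> carrier G" using ab(1) T by (simp add: mem_product_one_iff)
      ultimately have TB: "T \<in> carrier ?B" using * c(1) d(1) by blast
      have "x = quotient_embed ?B T"
        unfolding x quotient_embed_def product_one_simps(2)
        by (subst fraction_eq_iff[OF ab TB e]) (simp add: T)
      then show "x \<in> quotient_embed ?B ` carrier ?B" using TB by blast
    qed
  }
qed

text \<open>The threshold is lowered one step at a time. If all powers from \<open>Suc N\<close> on
  are product-one and \<open>N\<close> is positive, then \<open>2 * N\<close> and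
  \<open>3 * N\<close> are beyond the threshold, so seminormality applies to the \<open>N\<close>-th
  power. Thresholds 0 and 1 already cover the exponent 1.\<close>

lemma seminormal_root_closed:
  assumes semi: "seminormal (product_one G)" and V: "set_mset V \<subseteq> carrier G"
    and "\<And>m. m \<ge> N \<Longrightarrow> repeat_mset m V \<in> carrier (product_one G)"
  shows "V \<in> carrier (product_one G)"
  using assms(3)
proof (induction N)
  case 0
  show ?case using 0[of 1] by simp
next
  case (Suc N)
  show ?case
  proof (cases "N = 0")
    case True
    show ?thesis using Suc.prems[of 1] True by simp
  next
    case False
    have "repeat_mset (2 * N) V \<in> carrier (product_one G)" "repeat_mset (3 * N) V \<in> carrier (product_one G)"
      by (rule Suc.prems, use False in linarith)+
    then have "repeat_mset 2 (repeat_mset N V) \<in> carrier (product_one G)"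
      "repeat_mset 3 (repeat_mset N V) \<in> carrier (product_one G)"
      by (simp_all only: repeat_mset_right)
    then have N: "repeat_mset N V \<in> carrier (product_one G)"
      using semi repeat_closed[OF V, of N] unfolding seminormal_product_one_iff by blast
    show ?thesis
    proof (rule Suc.IH)
      fix m assume "N \<le> m"
      then show "repeat_mset m V \<in> carrier (product_one G)"
        using N Suc.prems[of m] by (cases "m = N") auto
    qed
  qed
qed

lemma clifford_iff_seminormal:
  assumes fin: "finite (carrier G)"
  shows "clifford (seq_class_semigroup G) \<longleftrightarrow> seminormal (product_one G)"
proof
  assume cl: "clifford (seq_class_semigroup G)"
  show "seminormal (product_one G)"
    unfolding seminormal_product_one_iff
  proof (intro allI impI)
    fix T assume T: "set_mset T \<subseteq> carrier G"
      and 2: "repeat_mset 2 T \<in> carrier (product_one G)" and 3: "repeat_mset 3 T \<in> carrier (product_one G)"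
    \<comment> \<open>Every exponent from 2 on is a sum of twos and at most one three.\<close>
    have large: "repeat_mset m T \<in> carrier (product_one G)" if "m \<ge> 2" for m
    proof (cases "even m")
      case True
      then obtain a where "m = a * 2" by (metis evenE mult.commute)
      then show ?thesis using product_one_repeat[OF 2, of a] by (simp only: repeat_mset_right)
    next
      case False
      then obtain a where "m = 2 * a + 1" by (rule oddE)
      then have "m = (a - 1) * 2 + 3" using that by simp
      moreover have "repeat_mset (a - 1) (repeat_mset 2 T) + repeat_mset 3 T \<in> carrier (product_one G)"
        using product_one_repeat[OF 2] 3 by (rule product_one_add)
      ultimately show ?thesis by (simp only: repeat_mset_right repeat_mset_distrib)
    qed
    obtain k where k: "k > 0" "seq_class G (repeat_mset k T) \<in> idempotents (seq_class_semigroup G)"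
      using ex_repeat_idempotent[OF fin T] by blast
    have "seq_class G (repeat_mset (Suc k) T) = seq_class G T"
      by (rule clifford_seq_class_Suc[OF cl T k])
    then have "repeat_mset (Suc k) T \<in> carrier (product_one G) \<longleftrightarrow> T \<in> carrier (product_one G)"
      using repeat_closed[OF T] T by (rule product_one_seq_class_cong)
    then show "T \<in> carrier (product_one G)"
      using large[of "Suc k"] k(1) by simp
  qed
next
  assume semi: "seminormal (product_one G)"
  interpret C: comm_monoid "seq_class_semigroup G" by (rule comm_monoid_seq_class_semigroup)
  show "clifford (seq_class_semigroup G)"
    unfolding C.clifford_iff
  proof
    fix x assume "x \<in> carrier (seq_class_semigroup G)"
    then obtain T where x: "x = seq_class G T" and T: "set_mset T \<subseteq> carrier G"
      by (auto simp: carrier_seq_class_semigroup)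
    obtain k where k: "k > 0" "order G dvd k"
      and idem: "seq_class G (repeat_mset k T) \<in> idempotents (seq_class_semigroup G)"
      using ex_repeat_idempotent[OF fin T] by blast
    have rT: "set_mset (repeat_mset m T) \<subseteq> carrier G" for m by (rule repeat_closed[OF T])
    \<comment> \<open>Write \<open>m * Suc k = (m - k) + Suc m * k\<close> and
      \<open>m = (m - k) + k\<close>; positive multiples of \<open>k\<close> all give the same
      idempotent class.\<close>
    have shift: "seq_class G (repeat_mset (m * Suc k) T) = seq_class G (repeat_mset m T)" if "m \<ge> k" for m
    proof -
      have "m * Suc k = (m - k) + Suc m * k" "m = (m - k) + k" using that by simp_all
      then have "repeat_mset (m * Suc k) T = repeat_mset (m - k) T + repeat_mset (Suc m * k) T"
        "repeat_mset m T = repeat_mset (m - k) T + repeat_mset k T"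
        by (metis repeat_mset_distrib)+
      moreover have "seq_class G (repeat_mset (m - k) T + repeat_mset (Suc m * k) T) =
        seq_class G (repeat_mset (m - k) T + repeat_mset k T)"
        by (rule seq_class_add_cong) (use rT seq_class_repeat_mult[OF T _ idem, of "Suc m"] in blast)+
      ultimately show ?thesis by (simp only:)
    qed
    have "T + W \<in> carrier (product_one G) \<longleftrightarrow> repeat_mset (Suc k) T + W \<in> carrier (product_one G)"
      if W: "set_mset W \<subseteq> carrier G" for W
    proof
      assume "T + W \<in> carrier (product_one G)"
      \<comment> \<open>Divisibility of \<open>k\<close> by \<open>order G\<close> enters here: the
        \<open>k\<close>-th power of \<open>T\<close> is product-one.\<close>
      with repeat_order_product_one[OF fin T k(2)]
      have "repeat_mset k T + (T + W) \<in> carrier (product_one G)" by (rule product_one_add)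
      then show "repeat_mset (Suc k) T + W \<in> carrier (product_one G)"
        by (simp only: repeat_mset_Suc add_ac)
    next
      assume B: "repeat_mset (Suc k) T + W \<in> carrier (product_one G)"
      show "T + W \<in> carrier (product_one G)"
      proof (rule seminormal_root_closed[OF semi, of _ k])
        fix m assume m: "k \<le> m"
        have "repeat_mset (m * Suc k) T + repeat_mset m W \<in> carrier (product_one G)"
          using product_one_repeat[OF B, of m] by (simp only: repeat_mset_distrib2 repeat_mset_right)
        then have "repeat_mset m T + repeat_mset m W \<in> carrier (product_one G)"
          using seq_class_eqD[OF shift[OF m] rT rT repeat_closed[OF W]] by blast
        then show "repeat_mset m (T + W) \<in> carrier (product_one G)"
          by (simp only: repeat_mset_distrib2)
      qed (use T W in simp)
    qed
    then have Suc: "seq_class G (T + repeat_mset k T) = seq_class G T"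
      using seq_class_eq_iff[OF T rT, of "Suc k"] unfolding repeat_mset_Suc by metis
    let ?e = "seq_class G (repeat_mset k T)"
    have 1: "x \<otimes>\<^bsub>seq_class_semigroup G\<^esub> ?e = x"
      unfolding x using Suc by (simp only: mult_seq_class_semigroup[OF T rT])
    \<comment> \<open>The power with exponent \<open>k - 1\<close> inverts \<open>x\<close> up to
      the idempotent; for \<open>k = 1\<close> it is the empty sequence.\<close>
    have "k = Suc (k - 1)" using k(1) by simp
    then have "T + repeat_mset (k - 1) T = repeat_mset k T" by (metis repeat_mset_Suc)
    then have 2: "x \<otimes>\<^bsub>seq_class_semigroup G\<^esub> seq_class G (repeat_mset (k - 1) T) = ?e"
      unfolding x by (simp only: mult_seq_class_semigroup[OF T rT])
    have "x \<in> green_H (seq_class_semigroup G) ?e"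
      using C.green_H_idempotent_iff[OF idem] 1 2 seq_class_closed[OF T] seq_class_closed[OF rT] x by blast
    then show "\<exists>e\<in>idempotents (seq_class_semigroup G). x \<in> green_H (seq_class_semigroup G) e"
      using idem by blast
  qed
qed

end


section \<open>The kernels of the homomorphisms attached to the idempotent classes\<close>

context group
begin

lemma derived_subsetI:
  assumes "subgroup P G"
    and "\<And>x y. x \<in> H \<Longrightarrow> y \<in> H \<Longrightarrow> x \<otimes> y \<otimes> inv x \<otimes> inv y \<in> P"
  shows "derived G H \<subseteq> P"
  unfolding derived_def by (rule generate_subgroup_incl[OF _ assms(1)]) (use assms(2) in blast)

lemma commutator_in_derived:
  "x \<in> H \<Longrightarrow> y \<in> H \<Longrightarrow> x \<otimes> y \<otimes> inv x \<otimes> inv y \<in> derived G H"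
  unfolding derived_def by (rule generate.incl) blast

text \<open>Modulo the commutator subgroup multiplication is commutative, so the coset of a product
  depends only on the multiset of factors.\<close>

lemma products_derived_coset:
  assumes S: "set_mset S \<subseteq> carrier G" and x: "x \<in> products G S" and y: "y \<in> products G S"
  shows "derived G (carrier G) #> x = derived G (carrier G) #> y"
proof -
  let ?D = "derived G (carrier G)"
  let ?Q = "G Mod ?D"
  interpret D: normal ?D G by (rule derived_self_is_normal)
  interpret Q: comm_group ?Q by (rule derived_quot_is_comm_group)
  have foldr: "?D #> foldr (\<otimes>) xs \<one> = foldr (\<otimes>\<^bsub>?Q\<^esub>) (map (\<lambda>a. ?D #> a) xs) \<one>\<^bsub>?Q\<^esub>"
    if "set xs \<subseteq> carrier G" for xs
    using that
  proof (induction xs)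
    case Nil
    show ?case using D.subset by (simp add: FactGroup_def)
  next
    case (Cons a xs)
    then have "?D #> (a \<otimes> foldr (\<otimes>) xs \<one>) = (?D #> a) <#> (?D #> foldr (\<otimes>) xs \<one>)"
      by (intro D.rcos_sum[symmetric]) auto
    then show ?case using Cons by (simp add: FactGroup_def)
  qed
  obtain xs where xs: "mset xs = S" "x = foldr (\<otimes>) xs \<one>" using x by (rule productsE)
  obtain ys where ys: "mset ys = S" "y = foldr (\<otimes>) ys \<one>" using y by (rule productsE)
  have sub: "set xs \<subseteq> carrier G" "set ys \<subseteq> carrier G"
    using S unfolding xs(1)[symmetric] using S unfolding ys(1)[symmetric] by simp_all
  have "mset (map (\<lambda>a. ?D #> a) xs) = mset (map (\<lambda>a. ?D #> a) ys)" using xs(1) ys(1) by simp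
  moreover have "set (map (\<lambda>a. ?D #> a) xs) \<subseteq> carrier ?Q"
    using sub(1) by (auto simp: FactGroup_def RCOSETS_def)
  ultimately show ?thesis
    unfolding xs(2) ys(2) foldr[OF sub(1)] foldr[OF sub(2)] by (rule Q.multlist_perm_cong)
qed

lemma products_subset_derived:
  assumes "S \<in> carrier (product_one G)"
  shows "products G S \<subseteq> derived G (carrier G)"
proof
  fix x assume x: "x \<in> products G S"
  have S: "set_mset S \<subseteq> carrier G" "\<one> \<in> products G S" using assms by (simp_all add: mem_product_one_iff)
  have D: "subgroup (derived G (carrier G)) G" by (rule derived_is_subgroup) simp
  have xc: "x \<in> carrier G" using products_closed[OF S(1)] x by blast
  have "derived G (carrier G) #> x = derived G (carrier G) #> \<one>"
    by (rule products_derived_coset[OF S(1) x S(2)])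
  then have "derived G (carrier G) #> x = derived G (carrier G)"
    using coset_mult_one[OF subgroup.subset[OF D]] by simp
  then show "x \<in> derived G (carrier G)" using rcos_self[OF xc D] by simp
qed

text \<open>In a finite group the inverse is the power with exponent \<open>order G - 1\<close>,
  which any submonoid contains.\<close>

lemma finite_submonoid_is_subgroup:
  assumes fin: "finite (carrier G)" and P: "submonoid P G"
  shows "subgroup P G"
proof -
  interpret P: submonoid P G by (rule P)
  have pow: "p [^] (n::nat) \<in> P" if "p \<in> P" for p n
    by (induction n) (simp_all add: that)
  have "inv p \<in> P" if p: "p \<in> P" for p
  proof -
    have pc: "p \<in> carrier G" using p P.subset by blast
    have "order G = Suc (order G - 1)" using fin order_gt_0_iff_finite by simp
    then have "p [^] (order G - 1) \<otimes> p = \<one>" using pow_order_eq_1[OF pc] by (metis nat_pow_Suc)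
    then have "inv p = p [^] (order G - 1)" using pc by (intro inv_equality) simp_all
    then show ?thesis using pow[OF p] by simp
  qed
  then show ?thesis by (intro subgroup.intro) (use P.subset in auto)
qed

text \<open>Multiplying two products of \<open>T\<close> gives a product of \<open>T + T\<close>,
  which has the same class and hence the same products as \<open>T\<close>.\<close>

lemma products_of_idempotent_subgroup:
  assumes fin: "finite (carrier G)" and T: "T \<in> carrier (product_one G)"
    and idem: "seq_class G T \<in> idempotents (seq_class_semigroup G)"
  shows "subgroup (products G T) G"
proof (rule finite_submonoid_is_subgroup[OF fin], rule submonoid.intro)
  have Tc: "set_mset T \<subseteq> carrier G" "\<one> \<in> products G T" using T by (simp_all add: mem_product_one_iff)
  show "products G T \<subseteq> carrier G" by (rule products_closed[OF Tc(1)])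
  show "\<one> \<in> products G T" by (rule Tc)
  fix p q assume "p \<in> products G T" "q \<in> products G T"
  then have "p \<otimes> q \<in> products G (T + T)" using Tc(1) by (intro products_add)
  moreover have "products G (T + T) = products G T"
    using idem Tc(1) by (intro products_eq_if_seq_class_eq) (simp_all add: seq_class_idempotent_iff)
  ultimately show "p \<otimes> q \<in> products G T" by simp
qed

section \<open>The group generated by the product-one sequences of an idempotent class\<close>

lemma carrier_support_group:
  "carrier (support_group G A) = generate G (\<Union>S \<in> A \<inter> carrier (product_one G). set_mset S)"
  by (simp add: support_group_def)

lemma subgroup_support_group: "subgroup (carrier (support_group G A)) G"
  unfolding carrier_support_group
  by (rule generate_is_subgroup) (auto simp: mem_product_one_iff)

lemma group_support_group: "group (support_group G A)"
  using subgroup_imp_group[OF subgroup_support_group] by (simp add: support_group_def)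

lemma derived_support_group:
  "derived (support_group G A) (carrier (support_group G A)) = derived G (carrier (support_group G A))"
  using derived_consistent[OF subset_refl subgroup_support_group] by (simp add: support_group_def)

lemma products_support_group: "products (support_group G A) S = products G S"
  by (simp add: products_def support_group_def)

lemma set_mset_subset_support_group:
  assumes "T \<in> A" and "T \<in> carrier (product_one G)"
  shows "set_mset T \<subseteq> carrier (support_group G A)"
proof
  fix x assume "x \<in># T"
  then have "x \<in> (\<Union>S \<in> A \<inter> carrier (product_one G). set_mset S)" using assms by (intro UN_I[of T]) simp_all
  then show "x \<in> carrier (support_group G A)" unfolding carrier_support_group by (rule generate.incl)
qed

text \<open>The products lie in the derived subgroup because \<open>T\<close> is product-one over
  the smaller group as well. For the converse, a commutator is realised as a product of some
  sequence in the class of \<open>T\<close>; this needs \<open>a\<close> and \<open>inv a\<close> to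
  be products of two sequences whose sum lies in that class.\<close>

lemma products_eq_derived_support_group:
  assumes fin: "finite (carrier G)" and T: "T \<in> carrier (product_one G)"
    and idem: "seq_class G T \<in> idempotents (seq_class_semigroup G)"
  shows "products G T = derived (support_group G (seq_class G T)) (carrier (support_group G (seq_class G T)))"
proof
  let ?K = "support_group G (seq_class G T)"
  have Tc: "set_mset T \<subseteq> carrier G" using T by (simp add: mem_product_one_iff)
  have "\<one>\<^bsub>?K\<^esub> = \<one>" by (simp add: support_group_def)
  then have "T \<in> carrier (product_one ?K)"
    using T set_mset_subset_support_group[OF seq_class_self[OF Tc] T]
    by (simp only: mem_product_one_iff products_support_group)
  then show "products G T \<subseteq> derived ?K (carrier ?K)"
    using group.products_subset_derived[OF group_support_group] unfolding products_support_group by blast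
  have P: "subgroup (products G T) G" by (rule products_of_idempotent_subgroup[OF fin T idem])
  have TT: "seq_class G (T + T) = seq_class G T" using idem seq_class_idempotent_iff[OF Tc] by blast
  have add: "seq_class G (U + V) = seq_class G T"
    if "set_mset U \<subseteq> carrier G" "set_mset V \<subseteq> carrier G"
      "seq_class G U = seq_class G T" "seq_class G V = seq_class G T" for U V
    using seq_class_add_cong[OF that(1,2) Tc Tc that(3,4)] TT by simp
  \<comment> \<open>A generator \<open>h\<close> occurs in a product-one sequence of the class, hence its inverse is a
    product of the remaining terms of that sequence.\<close>
  have rest: "\<exists>U V. set_mset U \<subseteq> carrier G \<and> set_mset V \<subseteq> carrier G \<and>
      seq_class G (U + V) = seq_class G T \<and> inv h \<in> products G U \<and> h \<in> products G V \<and> h \<in> carrier G"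
    if h: "h \<in> (\<Union>S \<in> seq_class G T \<inter> carrier (product_one G). set_mset S)" for h
  proof -
    obtain V where V: "V \<in> seq_class G T" "V \<in> carrier (product_one G)" "h \<in># V" using h by blast
    have Vc: "set_mset V \<subseteq> carrier G" using V(2) by (simp add: mem_product_one_iff)
    obtain U where U: "V = U + {#h#}" using V(3) by (metis add_mset_add_single insert_DiffM)
    then have c: "set_mset U \<subseteq> carrier G" "h \<in> carrier G" using Vc by auto
    have "U + {#inv (inv h)#} \<in> carrier (product_one G)" using V(2) U c by simp
    then have "inv h \<in> products G U" using mem_products_iff[OF c(1), of "inv h"] c(2) by blast
    moreover have "seq_class G (U + {#h#}) = seq_class G T"
      using V(1) U by (simp add: mem_seq_class_iff[OF Tc])
    ultimately show ?thesis
      using mem_products_singleton c by (intro exI[of _ U] exI[of _ "{#h#}"]) simp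
  qed
  have reach: "\<exists>U V. set_mset U \<subseteq> carrier G \<and> set_mset V \<subseteq> carrier G \<and>
      seq_class G (U + V) = seq_class G T \<and> a \<in> products G U \<and> inv a \<in> products G V"
    if "a \<in> carrier ?K" for a
    using that unfolding carrier_support_group
  proof (induction a rule: generate.induct)
    \<comment> \<open>The pair is the empty sequence and \<open>T\<close>, the latter having the
      identity among its products.\<close>
    case one
    show ?case
      by (rule exI[of _ "{#}"], rule exI[of _ T])
        (use T in \<open>simp add: products_empty mem_product_one_iff\<close>)
  next
    case (incl h)
    from rest[OF this] show ?case by (metis add.commute)
  next
    case (inv h)
    from rest[OF this] show ?case by (metis inv_inv)
  next
    case (eng a b)
    obtain U V where UV: "set_mset U \<subseteq> carrier G" "set_mset V \<subseteq> carrier G"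
      "seq_class G (U + V) = seq_class G T" "a \<in> products G U" "inv a \<in> products G V"
      using eng.IH(1) by blast
    obtain U' V' where UV': "set_mset U' \<subseteq> carrier G" "set_mset V' \<subseteq> carrier G"
      "seq_class G (U' + V') = seq_class G T" "b \<in> products G U'" "inv b \<in> products G V'"
      using eng.IH(2) by blast
    have ab: "a \<in> carrier G" "b \<in> carrier G" using products_closed UV(1,4) UV'(1,4) by blast+
    have "a \<otimes> b \<in> products G (U + U')" by (rule products_add[OF UV(1) UV'(1) UV(4) UV'(4)])
    \<comment> \<open>Inversion reverses the factors, so \<open>V'\<close> comes before
      \<open>V\<close>; as a sequence the order is immaterial.\<close>
    moreover have "inv (a \<otimes> b) \<in> products G (V' + V)"
      unfolding inv_mult_group[OF ab] by (rule products_add[OF UV'(2) UV(2) UV'(5) UV(5)])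
    moreover have "seq_class G ((U + V) + (U' + V')) = seq_class G T"
      by (rule add) (use UV UV' in simp_all)
    then have "seq_class G ((U + U') + (V' + V)) = seq_class G T" by (simp only: add_ac)
    moreover have "set_mset (U + U') \<subseteq> carrier G" "set_mset (V' + V) \<subseteq> carrier G"
      using UV(1,2) UV'(1,2) by simp_all
    ultimately show ?case by blast
  qed
  show "derived ?K (carrier ?K) \<subseteq> products G T"
    unfolding derived_support_group
  proof (rule derived_subsetI[OF P])
    fix a b assume "a \<in> carrier ?K" "b \<in> carrier ?K"
    obtain U V where UV: "set_mset U \<subseteq> carrier G" "set_mset V \<subseteq> carrier G"
      "seq_class G (U + V) = seq_class G T" "a \<in> products G U" "inv a \<in> products G V"
      using reach[OF \<open>a \<in> carrier ?K\<close>] by blast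
    obtain U' V' where UV': "set_mset U' \<subseteq> carrier G" "set_mset V' \<subseteq> carrier G"
      "seq_class G (U' + V') = seq_class G T" "b \<in> products G U'" "inv b \<in> products G V'"
      using reach[OF \<open>b \<in> carrier ?K\<close>] by blast
    \<comment> \<open>The product is read off in commutator order, while the class is computed after
      regrouping into \<open>U + V\<close> and \<open>U' + V'\<close>, both in the idempotent
      class.\<close>
    have "a \<otimes> b \<otimes> inv a \<otimes> inv b \<in> products G (U + U' + V + V')"
      by (intro products_add) (use UV UV' in simp_all)
    moreover have "seq_class G ((U + V) + (U' + V')) = seq_class G T"
      by (rule add) (use UV UV' in simp_all)
    then have "seq_class G (U + U' + V + V') = seq_class G T" by (simp only: add_ac)
    then have "products G (U + U' + V + V') = products G T"
      by (intro products_eq_if_seq_class_eq) (use UV UV' Tc in simp_all)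
    ultimately show "a \<otimes> b \<otimes> inv a \<otimes> inv b \<in> products G T" by simp
  qed
qed

text \<open>Some power of \<open>T\<close> has class \<open>e\<close>, and \<open>T\<close> and that
  power pass the same tests. Adding the missing copies of the product-one \<open>T\<close> leads
  from \<open>T\<close> to the power; adding one more \<open>T\<close> and absorbing
  \<open>e\<close> leads back.\<close>

lemma product_one_in_green_H:
  assumes fin: "finite (carrier G)" and T: "T \<in> carrier (product_one G)"
    and e: "e \<in> idempotents (seq_class_semigroup G)"
    and "seq_class G T \<in> green_H (seq_class_semigroup G) e"
  shows "seq_class G T = e"
proof -
  interpret C: comm_monoid "seq_class_semigroup G" by (rule comm_monoid_seq_class_semigroup)
  have Tc: "set_mset T \<subseteq> carrier G" using T by (simp add: mem_product_one_iff)
  have rT: "set_mset (repeat_mset m T) \<subseteq> carrier G" for m by (rule repeat_closed[OF Tc])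
  obtain k where k: "k > 0" "seq_class G (repeat_mset k T) \<in> idempotents (seq_class_semigroup G)"
    using ex_repeat_idempotent[OF fin Tc] by blast
  have ke: "seq_class G (repeat_mset k T) = e"
    using C.pow_idempotent_in_green_H[OF e assms(4) k(1)] k(2) pow_seq_class[OF Tc] by simp
  have "seq_class G T \<otimes>\<^bsub>seq_class_semigroup G\<^esub> e = seq_class G T"
    using C.green_H_idempotent_iff[OF e] assms(4) by blast
  then have Tk: "seq_class G (T + repeat_mset k T) = seq_class G T"
    unfolding ke[symmetric] mult_seq_class_semigroup[OF Tc rT] .
  have "T + W \<in> carrier (product_one G) \<longleftrightarrow> repeat_mset k T + W \<in> carrier (product_one G)"
    if W: "set_mset W \<subseteq> carrier G" for W
  proof
    assume "T + W \<in> carrier (product_one G)"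
    then have "repeat_mset (k - 1) T + (T + W) \<in> carrier (product_one G)"
      by (rule product_one_add[OF product_one_repeat[OF T]])
    moreover have "repeat_mset k T = T + repeat_mset (k - 1) T"
      using k(1) by (metis Suc_diff_1 repeat_mset_Suc)
    ultimately show "repeat_mset k T + W \<in> carrier (product_one G)" by (simp only: add_ac)
  next
    assume "repeat_mset k T + W \<in> carrier (product_one G)"
    then have "T + (repeat_mset k T + W) \<in> carrier (product_one G)"
      by (rule product_one_add[OF T])
    then have "T + repeat_mset k T + W \<in> carrier (product_one G)" by (simp only: add.assoc)
    then show "T + W \<in> carrier (product_one G)"
      using seq_class_eqD[OF Tk _ Tc W] Tc rT by simp
  qed
  then have "seq_class G T = seq_class G (repeat_mset k T)"
    using seq_class_eq_iff[OF Tc rT] by blast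
  then show ?thesis using ke by simp
qed

lemma one_abelianization_support_group:
  "\<one>\<^bsub>abelianization (support_group G A)\<^esub> = derived (support_group G A) (carrier (support_group G A))"
  by (simp add: abelianization_def FactGroup_def)

lemma mem_phi_kernel_iff:
  assumes "set_mset T \<subseteq> carrier G"
  shows "seq_class G T \<in> phi_kernel G A \<longleftrightarrow> seq_class G T \<in> green_H (seq_class_semigroup G) A \<and>
    products G T = derived (support_group G A) (carrier (support_group G A))"
  using assms by (simp add: phi_kernel_def kernel_def H_group_def class_products_seq_class
      one_abelianization_support_group)

lemma product_one_iff_phi_kernel:
  assumes fin: "finite (carrier G)" and cl: "clifford (seq_class_semigroup G)"
    and T: "set_mset T \<subseteq> carrier G"
  shows "T \<in> carrier (product_one G) \<longleftrightarrow>
    (\<exists>e\<in>idempotents (seq_class_semigroup G). seq_class G T \<in> phi_kernel G e)"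
proof
  interpret C: comm_monoid "seq_class_semigroup G" by (rule comm_monoid_seq_class_semigroup)
  assume TB: "T \<in> carrier (product_one G)"
  obtain e where e: "e \<in> idempotents (seq_class_semigroup G)"
    "seq_class G T \<in> green_H (seq_class_semigroup G) e"
    using cl seq_class_closed[OF T] C.clifford_iff by blast
  have "seq_class G T = e" by (rule product_one_in_green_H[OF fin TB e])
  then have "seq_class G T \<in> phi_kernel G e"
    using mem_phi_kernel_iff[OF T] products_eq_derived_support_group[OF fin TB] e by simp
  with e(1) show "\<exists>e\<in>idempotents (seq_class_semigroup G). seq_class G T \<in> phi_kernel G e" by blast
next
  assume "\<exists>e\<in>idempotents (seq_class_semigroup G). seq_class G T \<in> phi_kernel G e"
  then obtain A where eq: "products G T = derived (support_group G A) (carrier (support_group G A))"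
    using mem_phi_kernel_iff[OF T] by blast
  have "\<one>\<^bsub>support_group G A\<^esub> \<in> derived (support_group G A) (carrier (support_group G A))"
    unfolding derived_def by (rule generate.one)
  then show "T \<in> carrier (product_one G)"
    using T eq by (simp add: mem_product_one_iff) (simp add: support_group_def)
qed


section \<open>Absence of a zero element\<close>

text \<open>Let V be a product-one power of \<open>g\<close>, \<open>h\<close> whose class is
  idempotent. Adding V leaves the class of the pair unchanged, so right multiplication by
  \<open>g \<otimes> h\<close> sends the products of V into the at most two products of the pair.
  These products form the derived subgroup of a group containing \<open>g\<close> and
  \<open>h\<close>. If \<open>g\<close> and \<open>h\<close> do not commute, this subgroup is
  therefore {1, z} with z their commutator, so z is an involution commuting with
  \<open>g\<close>.\<close>

lemma clifford_square_central:
  assumes fin: "finite (carrier G)" and cl: "clifford (seq_class_semigroup G)"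
    and g: "g \<in> carrier G" and h: "h \<in> carrier G"
  shows "g \<otimes> g \<otimes> h = h \<otimes> (g \<otimes> g)"
proof (cases "g \<otimes> h = h \<otimes> g")
  case True
  then show ?thesis using g h by (metis m_assoc)
next
  case False
  let ?T = "{#g, h#}"
  have T: "set_mset ?T \<subseteq> carrier G" using g h by simp
  obtain k where k: "k > 0" "order G dvd k" "seq_class G (repeat_mset k ?T) \<in> idempotents (seq_class_semigroup G)"
    using ex_repeat_idempotent[OF fin T] by blast
  let ?V = "repeat_mset k ?T"
  have V: "set_mset ?V \<subseteq> carrier G" by (rule repeat_closed[OF T])
  have VB: "?V \<in> carrier (product_one G)" by (rule repeat_order_product_one[OF fin T k(2)])
  let ?K = "carrier (support_group G (seq_class G ?V))"
  have K: "subgroup ?K G" by (rule subgroup_support_group)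
  have P: "products G ?V = derived G ?K"
    unfolding products_eq_derived_support_group[OF fin VB k(3)] by (rule derived_support_group)
  have Psub: "subgroup (products G ?V) G" by (rule products_of_idempotent_subgroup[OF fin VB k(3)])
  have "g \<in># ?V" "h \<in># ?V" using k(1) by (simp_all add: in_replicate_mset)
  then have ghK: "g \<in> ?K" "h \<in> ?K"
    using set_mset_subset_support_group[OF seq_class_self[OF V] VB] by blast+
  have "g \<otimes> h \<in> products G ?T" using g h by (intro productsI[of "[g, h]"]) simp_all
  then have "p \<otimes> (g \<otimes> h) \<in> products G (?V + ?T)" if "p \<in> products G ?V" for p
    using that by (intro products_add[OF V T])
  moreover have "products G (?V + ?T) = products G ?T"
  proof (rule products_eq_if_seq_class_eq)
    show "seq_class G (?V + ?T) = seq_class G ?T"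
      using clifford_seq_class_Suc[OF cl T k(1,3)] by (simp only: repeat_mset_Suc add.commute)
  qed (use V T in simp_all)
  ultimately have two: "p \<otimes> (g \<otimes> h) = g \<otimes> h \<or> p \<otimes> (g \<otimes> h) = h \<otimes> g" if "p \<in> products G ?V" for p
    using products_pair[OF g h] that by blast
  define z where "z = g \<otimes> h \<otimes> inv g \<otimes> inv h"
  have zc: "z \<in> carrier G" using g h by (simp add: z_def)
  have zgh: "z \<otimes> (h \<otimes> g) = g \<otimes> h"
    using g h by (simp add: z_def m_assoc) (simp flip: m_assoc)
  have zP: "z \<in> products G ?V" unfolding P z_def by (rule commutator_in_derived[OF ghK])
  have zK: "z \<in> ?K" unfolding z_def using K ghK by (simp add: subgroup.m_closed subgroup.m_inv_closed)
  have ne: "z \<noteq> \<one>" using zgh False g h by auto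
  have fixed: "p = z" if p: "p \<in> products G ?V" "p \<noteq> \<one>" for p
  proof -
    have pc: "p \<in> carrier G" using products_closed[OF V] p by blast
    have "q \<otimes> (g \<otimes> h) = h \<otimes> g" if q: "q \<in> products G ?V" "q \<noteq> \<one>" for q
    proof -
      have "q \<in> carrier G" using products_closed[OF V] q by blast
      then have "q \<otimes> (g \<otimes> h) \<noteq> g \<otimes> h" using right_cancel[of "g \<otimes> h" q \<one>] q(2) g h by simp
      then show ?thesis using two[OF q(1)] by blast
    qed
    then have "p \<otimes> (g \<otimes> h) = z \<otimes> (g \<otimes> h)" using p zP ne by simp
    then show ?thesis using pc zc g h by simp
  qed
  have "z \<otimes> z = \<one>"
  proof (rule ccontr)
    assume "z \<otimes> z \<noteq> \<one>"
    then have "z \<otimes> z = z" using fixed subgroup.m_closed[OF Psub zP zP] by blast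
    then show False using ne zc by simp
  qed
  \<comment> \<open>The conjugate of \<open>z\<close> by \<open>g\<close> is a commutator times
    \<open>z\<close>, so it stays in the two-element subgroup; being nontrivial, it equals
    \<open>z\<close>.\<close>
  have "g \<otimes> z \<otimes> inv g \<otimes> inv z \<in> products G ?V"
    unfolding P by (rule commutator_in_derived[OF ghK(1) zK])
  then have "g \<otimes> z \<otimes> inv g \<otimes> inv z \<otimes> z \<in> products G ?V" by (rule subgroup.m_closed[OF Psub _ zP])
  then have conj: "g \<otimes> z \<otimes> inv g \<in> products G ?V" using g zc by (simp add: m_assoc)
  have "g \<otimes> z \<otimes> inv g \<noteq> \<one>"
  proof
    assume "g \<otimes> z \<otimes> inv g = \<one>"
    then have "g \<otimes> z \<otimes> inv g \<otimes> g = g" using g by simp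
    then have "g \<otimes> z = g" using g zc by (simp add: m_assoc)
    then show False using ne g zc by simp
  qed
  then have "g \<otimes> z \<otimes> inv g = z" using fixed conj by blast
  then have "g \<otimes> z \<otimes> inv g \<otimes> g = z \<otimes> g" by simp
  then have gz: "g \<otimes> z = z \<otimes> g" using g zc by (simp add: m_assoc)
  \<comment> \<open>Moving the second \<open>g\<close> past \<open>h\<close> costs one factor
    \<open>z\<close>, moving the first costs another, and the two cancel.\<close>
  have "g \<otimes> g \<otimes> h = g \<otimes> (z \<otimes> (h \<otimes> g))" using g h zgh by (simp add: m_assoc)
  also have "\<dots> = z \<otimes> (g \<otimes> h) \<otimes> g" using g h zc gz by (metis m_assoc m_closed)
  also have "\<dots> = (z \<otimes> z) \<otimes> (h \<otimes> g) \<otimes> g" using g h zc zgh by (metis m_assoc m_closed)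
  also have "\<dots> = h \<otimes> (g \<otimes> g)" using \<open>z \<otimes> z = \<one>\<close> g h by (simp add: m_assoc)
  finally show ?thesis .
qed

text \<open>Centrality of the square of \<open>inv a\<close> allows it to be moved left past
  \<open>b\<close>, which turns \<open>u \<otimes> v \<otimes> w\<close>, a product of central
  squares, into the commutator.\<close>

lemma clifford_commutator_central:
  assumes fin: "finite (carrier G)" and cl: "clifford (seq_class_semigroup G)"
    and a: "a \<in> carrier G" and b: "b \<in> carrier G" and x: "x \<in> carrier G"
  shows "a \<otimes> b \<otimes> inv a \<otimes> inv b \<otimes> x = x \<otimes> (a \<otimes> b \<otimes> inv a \<otimes> inv b)"
proof -
  note sq = clifford_square_central[OF fin cl]
  define u v w where "u = (a \<otimes> b) \<otimes> (a \<otimes> b)" and "v = inv a \<otimes> inv a" and "w = inv b \<otimes> inv b"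
  have c: "u \<in> carrier G" "v \<in> carrier G" "w \<in> carrier G" using a b by (simp_all add: u_def v_def w_def)
  have cent: "u \<otimes> y = y \<otimes> u" "v \<otimes> y = y \<otimes> v" "w \<otimes> y = y \<otimes> w" if "y \<in> carrier G" for y
    unfolding u_def v_def w_def by (rule sq; use a b that in simp)+
  have "u \<otimes> v \<otimes> w = (a \<otimes> b \<otimes> a) \<otimes> (b \<otimes> v) \<otimes> w"
    using a b c by (simp add: u_def m_assoc)
  also have "\<dots> = (a \<otimes> b \<otimes> a) \<otimes> (v \<otimes> b) \<otimes> w" using cent(2)[OF b] by simp
  also have "\<dots> = a \<otimes> b \<otimes> inv a \<otimes> inv b"
  proof -
    have "a \<otimes> (inv a \<otimes> y) = y" "b \<otimes> (inv b \<otimes> y) = y" if "y \<in> carrier G" for y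
      using a b that by (simp_all flip: m_assoc)
    then show ?thesis using a b by (simp add: v_def w_def m_assoc)
  qed
  finally have eq: "u \<otimes> v \<otimes> w = a \<otimes> b \<otimes> inv a \<otimes> inv b" .
  have "u \<otimes> v \<otimes> w \<otimes> x = u \<otimes> v \<otimes> (x \<otimes> w)" using c x cent(3)[OF x] by (simp add: m_assoc)
  also have "\<dots> = u \<otimes> (x \<otimes> v) \<otimes> w" using c x cent(2)[OF x] by (metis m_assoc m_closed)
  also have "\<dots> = x \<otimes> (u \<otimes> v \<otimes> w)" using c x cent(1)[OF x] by (metis m_assoc m_closed)
  finally show ?thesis unfolding eq .
qed

text \<open>The products of \<open>Z\<close> absorb every right factor \<open>x\<close>, because
  adding the term \<open>x\<close> does not change the class. Hence they fill G, and
  \<open>Z\<close> is product-one, so its products also lie in the derived subgroup.\<close>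

lemma clifford_zero_imp_trivial:
  assumes fin: "finite (carrier G)" and cl: "clifford (seq_class_semigroup G)"
    and Z: "set_mset Z \<subseteq> carrier G"
    and zero: "\<And>T. set_mset T \<subseteq> carrier G \<Longrightarrow> seq_class G (Z + T) = seq_class G Z"
  shows "carrier G = {\<one>}"
proof -
  have mult: "p \<otimes> x \<in> products G Z" if "p \<in> products G Z" "x \<in> carrier G" for p x
  proof -
    have xs: "set_mset {#x#} \<subseteq> carrier G" using that by simp
    have "p \<otimes> x \<in> products G (Z + {#x#})"
      using that by (intro products_add[OF Z xs] mem_products_singleton)
    moreover have "products G (Z + {#x#}) = products G Z"
      by (rule products_eq_if_seq_class_eq[OF _ Z zero[OF xs]]) (use Z xs in simp)
    ultimately show ?thesis by simp
  qed
  obtain p where p: "p \<in> products G Z" using products_nonempty by blast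
  then have pc: "p \<in> carrier G" using products_closed[OF Z] by blast
  have one: "\<one> \<in> products G Z" using mult[OF p, of "inv p"] pc by simp
  then have ZB: "Z \<in> carrier (product_one G)" using Z by (simp add: mem_product_one_iff)
  have "carrier G \<subseteq> products G Z" using mult[OF one] by auto
  then have perfect: "carrier G \<subseteq> derived G (carrier G)"
    using products_subset_derived[OF ZB] by blast
  \<comment> \<open>The centre of G; it contains all commutators and hence, by perfectness,
    everything.\<close>
  define C where "C = {c \<in> carrier G. \<forall>x\<in>carrier G. c \<otimes> x = x \<otimes> c}"
  have "submonoid C G"
  proof
    show "C \<subseteq> carrier G" "\<one> \<in> C" by (auto simp: C_def)
    fix c d assume "c \<in> C" "d \<in> C"
    then have cd: "c \<in> carrier G" "d \<in> carrier G"
      and c: "\<And>x. x \<in> carrier G \<Longrightarrow> c \<otimes> x = x \<otimes> c" and d: "\<And>x. x \<in> carrier G \<Longrightarrow> d \<otimes> x = x \<otimes> d"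
      by (auto simp: C_def)
    have "c \<otimes> d \<otimes> x = x \<otimes> (c \<otimes> d)" if x: "x \<in> carrier G" for x
    proof -
      have "c \<otimes> d \<otimes> x = c \<otimes> x \<otimes> d" using cd x d[OF x] by (simp add: m_assoc)
      also have "\<dots> = x \<otimes> (c \<otimes> d)" unfolding c[OF x] using cd x by (simp add: m_assoc)
      finally show ?thesis .
    qed
    then show "c \<otimes> d \<in> C" using cd by (simp add: C_def)
  qed
  then have "subgroup C G" by (rule finite_submonoid_is_subgroup[OF fin])
  then have "derived G (carrier G) \<subseteq> C"
    by (rule derived_subsetI) (use clifford_commutator_central[OF fin cl] in \<open>simp add: C_def\<close>)
  then have comm: "x \<otimes> y = y \<otimes> x" if "x \<in> carrier G" "y \<in> carrier G" for x y
    using perfect that by (auto simp: C_def)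
  have "derived G (carrier G) \<subseteq> {\<one>}"
  proof (rule derived_subsetI[OF triv_subgroup])
    fix x y assume xy: "x \<in> carrier G" "y \<in> carrier G"
    then have "x \<otimes> y \<otimes> inv x \<otimes> inv y = y \<otimes> (x \<otimes> inv x) \<otimes> inv y" using comm[OF xy] by (simp add: m_assoc)
    also have "\<dots> = \<one>" using xy by simp
    finally show "x \<otimes> y \<otimes> inv x \<otimes> inv y \<in> {\<one>}" by simp
  qed
  then show ?thesis using perfect by auto
qed

end


section \<open>The class semigroup as a subdirect product\<close>

context group
begin

lemma star_tuple_eq: "star_tuple G n S T = (\<lambda>i\<in>{1..n}. seq_class G (T + S i))"
  by (simp add: star_tuple_def)

lemma carrier_comp_monoid: "carrier (comp_monoid G S i) = translate (seq_class_semigroup G) (seq_class G (S i))"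
  by (simp add: comp_monoid_def local_monoid_def)

lemma carrier_star: "carrier (star G n S) = star_tuple G n S ` {T. set_mset T \<subseteq> carrier G}"
  by (auto simp: star_def)

lemma mult_star:
  "x \<otimes>\<^bsub>star G n S\<^esub> y = (\<lambda>i\<in>{1..n}. x i \<otimes>\<^bsub>seq_class_semigroup G\<^esub> y i)"
  by (simp add: star_def comp_monoid_def local_monoid_def)

lemma mem_translate_seq_class_iff:
  assumes "set_mset U \<subseteq> carrier G"
  shows "x \<in> translate (seq_class_semigroup G) (seq_class G U) \<longleftrightarrow>
    (\<exists>T. set_mset T \<subseteq> carrier G \<and> x = seq_class G (T + U))"
proof -
  have "seq_class G U \<otimes>\<^bsub>seq_class_semigroup G\<^esub> seq_class G T = seq_class G (T + U)"
    if "set_mset T \<subseteq> carrier G" for T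
    using mult_seq_class_semigroup[OF assms that] by (simp add: add.commute)
  then show ?thesis by (auto simp: translate_def carrier_seq_class_semigroup)
qed

lemma star_proj_star_tuple:
  assumes "i \<in> {1..n}"
  shows "star_proj G S i (star_tuple G n S T) = rees_map (non_units (comp_monoid G S i)) (seq_class G (T + S i))"
  using assms by (simp add: star_proj_def star_tuple_eq)

lemma star_subset_product:
  assumes S: "\<And>i. i \<in> {1..n} \<Longrightarrow> set_mset (S i) \<subseteq> carrier G"
  shows "carrier (star G n S) \<subseteq> carrier (product_group {1..n} (comp_monoid G S))"
proof
  fix x assume "x \<in> carrier (star G n S)"
  then obtain T where T: "set_mset T \<subseteq> carrier G" "x = star_tuple G n S T" by (auto simp: carrier_star)
  have "seq_class G (T + S i) \<in> carrier (comp_monoid G S i)" if "i \<in> {1..n}" for i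
    using T(1) S[OF that] by (auto simp: carrier_comp_monoid mem_translate_seq_class_iff)
  then show "x \<in> carrier (product_group {1..n} (comp_monoid G S))"
    unfolding T(2) star_tuple_eq carrier_product_group by (rule restrict_PiE_iff[THEN iffD2, OF ballI])
qed

text \<open>The homomorphism property in one coordinate: the second copy of \<open>U\<close> is
  absorbed by idempotence.\<close>

lemma seq_class_add_idempotent:
  assumes "set_mset T \<subseteq> carrier G" "set_mset T' \<subseteq> carrier G" "set_mset U \<subseteq> carrier G"
    and "seq_class G U \<in> idempotents (seq_class_semigroup G)"
  shows "seq_class G (T + U) \<otimes>\<^bsub>seq_class_semigroup G\<^esub> seq_class G (T' + U) = seq_class G (T + T' + U)"
proof -
  have "seq_class G (T + U) \<otimes>\<^bsub>seq_class_semigroup G\<^esub> seq_class G (T' + U) = seq_class G ((T + T') + (U + U))"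
    using assms by (subst mult_seq_class_semigroup) (simp_all add: add_ac)
  also have "\<dots> = seq_class G (T + T' + U)"
    by (rule seq_class_add_cong) (use assms in \<open>simp_all add: seq_class_idempotent_iff\<close>)
  finally show ?thesis .
qed

lemma star_iso:
  assumes S: "\<And>i. i \<in> {1..n} \<Longrightarrow> set_mset (S i) \<subseteq> carrier G"
    and E: "idempotents (seq_class_semigroup G) = (\<lambda>i. seq_class G (S i)) ` {1..n}"
  shows "\<exists>\<phi> \<in> iso (seq_class_semigroup G) (star G n S).
    \<forall>T\<in>carrier (sequences G). \<phi> (seq_class G T) = star_tuple G n S T"
proof -
  \<comment> \<open>Multiplying the class itself by each idempotent avoids any choice of
    representative.\<close>
  define \<phi> where "\<phi> A = (\<lambda>i\<in>{1..n}. A \<otimes>\<^bsub>seq_class_semigroup G\<^esub> seq_class G (S i))" for A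
  have phi: "\<phi> (seq_class G T) = star_tuple G n S T" if "set_mset T \<subseteq> carrier G" for T
    unfolding \<phi>_def star_tuple_eq by (rule restrict_ext) (rule mult_seq_class_semigroup[OF that S])
  \<comment> \<open>The coordinate at the identity class returns the class of \<open>T\<close>,
    which makes evaluation at \<open>j\<close> a left inverse of \<open>\<phi>\<close>.\<close>
  have "seq_class G {#} \<in> idempotents (seq_class_semigroup G)" by (simp add: seq_class_idempotent_iff)
  then obtain j where j: "j \<in> {1..n}" "seq_class G (S j) = seq_class G {#}" using E by force
  have proj: "star_tuple G n S T j = seq_class G T" if "set_mset T \<subseteq> carrier G" for T
  proof -
    have "seq_class G (T + S j) = seq_class G (T + {#})"
      by (rule seq_class_add_cong) (use that S[OF j(1)] j(2) in simp_all)
    then show ?thesis using j(1) by (simp add: star_tuple_eq)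
  qed
  have "\<phi> \<in> iso (seq_class_semigroup G) (star G n S)"
  proof (rule isoI)
    show "\<phi> \<in> hom (seq_class_semigroup G) (star G n S)"
    proof (rule homI)
      fix x assume "x \<in> carrier (seq_class_semigroup G)"
      then obtain T where T: "x = seq_class G T" "set_mset T \<subseteq> carrier G"
        by (auto simp: carrier_seq_class_semigroup)
      then show "\<phi> x \<in> carrier (star G n S)" by (simp add: phi carrier_star)
      fix y assume "y \<in> carrier (seq_class_semigroup G)"
      then obtain T' where T': "y = seq_class G T'" "set_mset T' \<subseteq> carrier G"
        by (auto simp: carrier_seq_class_semigroup)
      have "seq_class G (T + T' + S i) = star_tuple G n S T i \<otimes>\<^bsub>seq_class_semigroup G\<^esub> star_tuple G n S T' i"
        if i: "i \<in> {1..n}" for i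
        using seq_class_add_idempotent[OF T(2) T'(2) S[OF i]] i E by (simp add: star_tuple_eq)
      then have "star_tuple G n S (T + T') = star_tuple G n S T \<otimes>\<^bsub>star G n S\<^esub> star_tuple G n S T'"
        unfolding mult_star star_tuple_eq[of n S "T + T'"] by (rule restrict_ext)
      then show "\<phi> (x \<otimes>\<^bsub>seq_class_semigroup G\<^esub> y) = \<phi> x \<otimes>\<^bsub>star G n S\<^esub> \<phi> y"
        unfolding T(1) T'(1) mult_seq_class_semigroup[OF T(2) T'(2)] using T(2) T'(2) by (simp add: phi)
    qed
    have "inj_on \<phi> (carrier (seq_class_semigroup G))"
    proof (rule inj_on_inverseI)
      fix x assume "x \<in> carrier (seq_class_semigroup G)"
      then show "\<phi> x j = x" by (auto simp: carrier_seq_class_semigroup phi proj)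
    qed
    moreover have "\<phi> ` carrier (seq_class_semigroup G) = carrier (star G n S)"
      unfolding carrier_seq_class_semigroup carrier_star image_image by (rule image_cong) (simp_all add: phi)
    ultimately show "bij_betw \<phi> (carrier (seq_class_semigroup G)) (carrier (star G n S))"
      by (simp add: bij_betw_def)
  qed
  then show ?thesis using phi by auto
qed

text \<open>The zero is pulled back along the isomorphism to a class fixed by all translations. This
  makes G trivial, so that all sequences are equivalent and the semigroup has only one
  element.\<close>

lemma star_no_zero:
  assumes fin: "finite (carrier G)" and cl: "clifford (seq_class_semigroup G)"
    and S: "\<And>i. i \<in> {1..n} \<Longrightarrow> set_mset (S i) \<subseteq> carrier G"
    and E: "idempotents (seq_class_semigroup G) = (\<lambda>i. seq_class G (S i)) ` {1..n}"
  shows "\<not> has_zero (star G n S)"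
proof
  assume "has_zero (star G n S)"
  then obtain z where z: "z \<in> carrier (star G n S)" "carrier (star G n S) \<noteq> {z}"
    "\<And>a. a \<in> carrier (star G n S) \<Longrightarrow> z \<otimes>\<^bsub>star G n S\<^esub> a = z" by (auto simp: has_zero_def)
  obtain \<phi> where \<phi>: "\<phi> \<in> iso (seq_class_semigroup G) (star G n S)"
    using star_iso[OF S E] by blast
  then have hom: "\<phi> \<in> hom (seq_class_semigroup G) (star G n S)"
    and inj: "inj_on \<phi> (carrier (seq_class_semigroup G))"
    and surj: "\<phi> ` carrier (seq_class_semigroup G) = carrier (star G n S)"
    by (auto simp: iso_def bij_betw_def)
  obtain Z where Z: "set_mset Z \<subseteq> carrier G" "z = \<phi> (seq_class G Z)"
    using z(1) unfolding surj[symmetric] carrier_seq_class_semigroup by blast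
  have zero: "seq_class G (Z + T) = seq_class G Z" if T: "set_mset T \<subseteq> carrier G" for T
  proof -
    have "\<phi> (seq_class G T) \<in> carrier (star G n S)" using seq_class_closed[OF T] surj by blast
    then have "\<phi> (seq_class G (Z + T)) = \<phi> (seq_class G Z)"
      using z(3) hom_mult[OF hom seq_class_closed[OF Z(1)] seq_class_closed[OF T]]
        mult_seq_class_semigroup[OF Z(1) T] Z(2) by simp
    moreover have "set_mset (Z + T) \<subseteq> carrier G" using Z(1) T by simp
    ultimately show ?thesis using inj_onD[OF inj] seq_class_closed Z(1) by blast
  qed
  have "carrier G = {\<one>}" by (rule clifford_zero_imp_trivial[OF fin cl Z(1) zero])
  then have "order G = 1" by (simp add: order_def)
  then have all: "T \<in> carrier (product_one G)" if "set_mset T \<subseteq> carrier G" for T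
    using repeat_order_product_one[OF fin that, of 1] by simp
  have "seq_class G T = seq_class G Z" if T: "set_mset T \<subseteq> carrier G" for T
  proof (subst seq_class_eq_iff[OF T Z(1)], intro allI impI)
    fix W assume "set_mset W \<subseteq> carrier G"
    then have "T + W \<in> carrier (product_one G)" "Z + W \<in> carrier (product_one G)"
      using T Z(1) by (auto intro!: all)
    then show "T + W \<in> carrier (product_one G) \<longleftrightarrow> Z + W \<in> carrier (product_one G)" by simp
  qed
  then have "carrier (star G n S) \<subseteq> {z}"
    unfolding surj[symmetric] carrier_seq_class_semigroup Z(2) by auto
  then show False using z(1,2) by blast
qed

end

theorem theorem3p6:
  fixes G :: "('a, 'b) monoid_scheme"
  assumes "group G" and "finite (carrier G)"
  shows
    "(clifford (seq_class_semigroup G) \<longleftrightarrow> seminormal (product_one G)) \<and>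
     (clifford (seq_class_semigroup G) \<longrightarrow>
       (\<forall>(n :: nat) (S :: nat \<Rightarrow> 'a multiset).
          (\<forall>i\<in>{1..n}. S i \<in> carrier (sequences G)) \<and>
          idempotents (seq_class_semigroup G) = (\<lambda>i. seq_class G (S i)) ` {1..n}
          \<longrightarrow>
          \<comment> \<open>the map is a well-defined isomorphism\<close>
          carrier (star G n S) \<subseteq> carrier (product_group {1..n} (comp_monoid G S)) \<and>
          (\<exists>\<phi> \<in> iso (seq_class_semigroup G) (star G n S).
             \<forall>T\<in>carrier (sequences G). \<phi> (seq_class G T) = star_tuple G n S T) \<and>
          \<comment> \<open>property 1\<close>
          (\<forall>i\<in>{1..n}. \<forall>j\<in>{1..n}. \<forall>T\<in>carrier (sequences G).
             seq_class G T \<in> green_H (seq_class_semigroup G) (seq_class G (S i)) \<longrightarrow>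
             (rees_le (seq_class_semigroup G) (seq_class G (S j)) (seq_class G (S i)) \<longleftrightarrow>
              seq_class G (T \<otimes>\<^bsub>sequences G\<^esub> S j)
                \<in> green_H (seq_class_semigroup G) (seq_class G (S j)))) \<and>
          \<comment> \<open>no zero element, neither as a semigroup nor in the form of the tuple (0, ..., 0)\<close>
          \<not> has_zero (star G n S) \<and>
          (\<forall>x\<in>carrier (star G n S). \<exists>i\<in>{1..n}. star_proj G S i x \<noteq> None) \<and>
          \<comment> \<open>property 2\<close>
          (\<forall>i\<in>{1..n}. carrier (comp_monoid G S i) =
             (\<Union>j\<in>{j\<in>{1..n}. rees_le (seq_class_semigroup G)
                                 (seq_class G (S j)) (seq_class G (S i))}.
                green_H (seq_class_semigroup G) (seq_class G (S j)))) \<and>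
          \<comment> \<open>property 3\<close>
          (\<forall>i\<in>{1..n}. star_proj G S i ` carrier (star G n S) =
             carrier (rees_quotient (comp_monoid G S i) (non_units (comp_monoid G S i)))) \<and>
          \<comment> \<open>property 4\<close>
          carrier (product_one G) =
            (\<Union>i\<in>{1..n}. {T \<in> carrier (sequences G).
               seq_class G T \<in> phi_kernel G (seq_class G (S i))})))"
proof -
  interpret group G by (rule assms(1))
  note fin = assms(2)
  let ?C = "seq_class_semigroup G"
  interpret C: comm_monoid ?C by (rule comm_monoid_seq_class_semigroup)
  show ?thesis
  proof (intro conjI clifford_iff_seminormal[OF fin] impI allI, goal_cases)
    case (1 n S)
    then show ?case using star_subset_product[of n S] by simp
  next
    case (2 n S)
    then show ?case using star_iso[of n S] by simp
  next
    case (3 n S)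
    show ?case
    proof (intro ballI impI)
      fix i j T
      assume ij: "i \<in> {1..n}" "j \<in> {1..n}" and T: "T \<in> carrier (sequences G)"
        and TH: "seq_class G T \<in> green_H ?C (seq_class G (S i))"
      have E: "seq_class G (S i) \<in> idempotents ?C" "seq_class G (S j) \<in> idempotents ?C"
        using 3 ij by blast+
      have "set_mset T \<subseteq> carrier G" "set_mset (S j) \<subseteq> carrier G" using 3 ij T by simp_all
      then show "rees_le ?C (seq_class G (S j)) (seq_class G (S i)) \<longleftrightarrow>
        seq_class G (T \<otimes>\<^bsub>sequences G\<^esub> S j) \<in> green_H ?C (seq_class G (S j))"
        using C.rees_le_iff_mult_green_H[OF E TH] by (simp add: mult_seq_class_semigroup)
    qed
  next
    case (4 n S)
    then show ?case using star_no_zero[OF fin, of n S] by simp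
  next
    case (5 n S)
    show ?case
    proof
      fix x assume "x \<in> carrier (star G n S)"
      then obtain T where T: "set_mset T \<subseteq> carrier G" "x = star_tuple G n S T" by (auto simp: carrier_star)
      \<comment> \<open>The coordinate to look at is the idempotent whose maximal subgroup contains
        the class of \<open>T\<close>: there the entry is that class itself, a unit, and is not sent
        to \<open>None\<close>.\<close>
      obtain e where "e \<in> idempotents ?C" "seq_class G T \<in> green_H ?C e"
        using 5(1) seq_class_closed[OF T(1)] C.clifford_iff by blast
      moreover from this 5(2) obtain i where "i \<in> {1..n}" "e = seq_class G (S i)" by auto
      ultimately have i: "i \<in> {1..n}" "seq_class G (S i) \<in> idempotents ?C"
        "seq_class G T \<in> green_H ?C (seq_class G (S i))" by simp_all
      have Si: "set_mset (S i) \<subseteq> carrier G" using 5 i(1) by simp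
      have "seq_class G T \<otimes>\<^bsub>?C\<^esub> seq_class G (S i) = seq_class G T"
        using C.green_H_idempotent_iff[OF i(2)] i(3) by blast
      then have "seq_class G (T + S i) = seq_class G T" using mult_seq_class_semigroup[OF T(1) Si] by simp
      moreover have "seq_class G T \<in> Units (comp_monoid G S i)"
        using C.green_H_subset_Units_local_monoid[OF i(2)] i(3) by (auto simp: comp_monoid_def)
      ultimately have "star_proj G S i x \<noteq> None"
        using star_proj_star_tuple[OF i(1), of S T] T(2) by (simp add: rees_map_def non_units_def)
      then show "\<exists>i\<in>{1..n}. star_proj G S i x \<noteq> None" using i(1) by blast
    qed
  next
    case (6 n S)
    show ?case
    proof
      fix i assume i: "i \<in> {1..n}"
      have "seq_class G (S i) \<in> idempotents ?C" using 6 i by blast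
      then have "carrier (comp_monoid G S i) =
        (\<Union>f\<in>{f \<in> idempotents ?C. rees_le ?C f (seq_class G (S i))}. green_H ?C f)"
        unfolding carrier_comp_monoid by (rule C.translate_idempotent_eq_Union[OF 6(1)])
      also have "\<dots> = (\<Union>j\<in>{j\<in>{1..n}. rees_le ?C (seq_class G (S j)) (seq_class G (S i))}.
        green_H ?C (seq_class G (S j)))"
      proof -
        have E: "idempotents ?C = (\<lambda>i. seq_class G (S i)) ` {1..n}" using 6(2) by blast
        show ?thesis unfolding E by blast
      qed
      finally show "carrier (comp_monoid G S i) =
        (\<Union>j\<in>{j\<in>{1..n}. rees_le ?C (seq_class G (S j)) (seq_class G (S i))}.
        green_H ?C (seq_class G (S j)))" .
    qed
  next
    case (7 n S)
    show ?case
    proof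
      fix i assume i: "i \<in> {1..n}"
      let ?N = "non_units (comp_monoid G S i)"
      have Si: "set_mset (S i) \<subseteq> carrier G" using 7 i by simp
      have "star_proj G S i ` carrier (star G n S) =
        rees_map ?N ` (\<lambda>T. seq_class G (T + S i)) ` {T. set_mset T \<subseteq> carrier G}"
        unfolding carrier_star image_image using star_proj_star_tuple[OF i] by (intro image_cong) simp_all
      also have "(\<lambda>T. seq_class G (T + S i)) ` {T. set_mset T \<subseteq> carrier G} = carrier (comp_monoid G S i)"
        unfolding carrier_comp_monoid by (rule Set.set_eqI) (auto simp: mem_translate_seq_class_iff[OF Si])
      \<comment> \<open>\<open>None\<close> is hit exactly when there are non-units, in agreement
        with the convention that the empty ideal adjoins no zero.\<close>
      also have "rees_map ?N ` carrier (comp_monoid G S i) = carrier (rees_quotient (comp_monoid G S i) ?N)"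
        by (auto simp: rees_quotient_def rees_map_def non_units_def)
      finally show "star_proj G S i ` carrier (star G n S) = carrier (rees_quotient (comp_monoid G S i) ?N)" .
    qed
  next
    case (8 n S)
    have "T \<in> carrier (product_one G) \<longleftrightarrow> set_mset T \<subseteq> carrier G \<and>
      (\<exists>i\<in>{1..n}. seq_class G T \<in> phi_kernel G (seq_class G (S i)))" for T
    proof (cases "set_mset T \<subseteq> carrier G")
      case True
      show ?thesis using product_one_iff_phi_kernel[OF fin 8(1) True] 8(2) True by simp
    qed (simp add: mem_product_one_iff)
    then show ?case by auto
  qed
qed

end
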